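(* Let $\mu_X$ be the Haar measure on $X$, $\nu\equiv 1$, and let $c_k:X\to\mathbb T$ be the functions $$c_{2\ell}(x)=1\ (\ell\ge 1),\qquad c_{4\ell+1}(x)=(-1)^{x_{4\ell+3}},\qquad c_{4\ell+3}(x)=(-1)^{x_{4\ell+1}}\ (\ell\ge 0).$$ These functions satisfy $c_k(x)^*=c_k(x+\delta_k)$ and $c_k(x)c_l(x+\delta_k)=c_l(x)c_k(x+\delta_l)$ for all $k,l$, and therefore the formulas $$(\mathbb J_{z_k}f)(x)=(-1)^{x_1+\dots+x_{k-1}+1}\,i\,c_k(x)\,f(x+\delta_k),\qquad (\mathbb J_{\sigma(z_k)}f)(x)=(-1)^{x_k}\,i\,(\mathbb J_{z_k}f)(x)$$ define a representation of $C_{\mathbb C}(Z)$ in $L_2(X)=L_2(X,\mu_X)$. This representation is irreducible. The real subspace $$L_2(X)^{\mathbb R}=\{f\in L_2(X):\ f(\mathbf 1-x)=\overline{f(x)}\ \text{for almost all }x\}$$ is invariant and irreducible under $C(Z)$. Furthermore, the representation of $C(Z)$ on $L_2(X)^{\mathbb R}$ so obtained does not arise from any representation of $C_{\mathbb C}(Z)$ by restriction of the scalars.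
   Context: $Z$ is an infinite-dimensional real separable Hilbert space, and $C(Z)$ is its Clifford algebra: the quotient of the real tensor algebra of $Z$ by the ideal generated by the elements $zw+wz+2(z,w)1$, $z,w\in Z$; $C_{\mathbb C}(Z)=\mathbb C\otimes C(Z)$. Fix an orthogonal complex structure $\sigma$ on $Z$ and a unitary basis $z_1,z_2,\dots$ of $(Z,\sigma)$, so that $\{z_k,\sigma(z_k)\}_{k\in\mathbb N}$ is a real orthonormal basis of $Z$. $X$ is the set of sequences $x=(x_1,x_2,\dots)$ with $x_k\in\{0,1\}$, a compact group under componentwise addition mod 2 (product topology); $\delta_k\in X$ has $k$-th entry $1$ and all others $0$; $\mathbf 1-x=(1-x_1,1-x_2,\dots)$. $\mathbb T$ is the unit circle in $\mathbb C$, and $L_2(X)$ consists of complex-valued functions. Representations of $C_{\mathbb C}(Z)$ are on separable complex Hilbert spaces with each $z\in Z$ acting by a skew-hermitian operator $\mathbb J_z$, where $z\mapsto\mathbb J_z$ is real linear and continuous (so $\mathbb J$ is determined by the operators $\mathbb J_{z_k},\mathbb J_{\sigma(z_k)}$). Irreducible means having no closed invariant (complex, resp. real) subspaces other than $\{0\}$ and the whole space. A representation of $C(Z)$ on a real Hilbert space $V$ arises from a representation of $C_{\mathbb C}(Z)$ by restriction of the scalars if it is the underlying real representation of some representation of $C_{\mathbb C}(Z)$; equivalently, if there is an orthogonal operator $T$ on $V$ with $T^2=-1$ commuting with the action of $C(Z)$. *)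

theory Defs
  imports "HOL-Probability.Infinite_Product_Measure" "HOL-Library.Poly_Mapping"
begin

section \<open>The Clifford algebra of a real inner product space\<close>

inductive_set ideal_generated :: "'a::ring set \<Rightarrow> 'a set" for S where
  gen: "s \<in> S \<Longrightarrow> s \<in> ideal_generated S"
| zero: "0 \<in> ideal_generated S"
| diff: "a \<in> ideal_generated S \<Longrightarrow> b \<in> ideal_generated S \<Longrightarrow> a - b \<in> ideal_generated S"
| mult_left: "a \<in> ideal_generated S \<Longrightarrow> r * a \<in> ideal_generated S"
| mult_right: "a \<in> ideal_generated S \<Longrightarrow> a * r \<in> ideal_generated S"

lemma ideal_generated_uminus: "a \<in> ideal_generated S \<Longrightarrow> - a \<in> ideal_generated S"
  using ideal_generated.diff[OF ideal_generated.zero, of a S] by simp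

lemma ideal_generated_add:
  "a \<in> ideal_generated S \<Longrightarrow> b \<in> ideal_generated S \<Longrightarrow> a + b \<in> ideal_generated S"
  using ideal_generated.diff[of a S "- b"] ideal_generated_uminus[of b S] by simp

lemma ideal_generated_equivp: "equivp (\<lambda>a b. a - b \<in> ideal_generated S)"
proof (rule equivpI)
  show "reflp (\<lambda>a b. a - b \<in> ideal_generated S)"
    by (rule reflpI) (simp add: ideal_generated.zero)
  show "symp (\<lambda>a b. a - b \<in> ideal_generated S)"
    by (rule sympI) (metis ideal_generated_uminus minus_diff_eq)
  show "transp (\<lambda>a b. a - b \<in> ideal_generated S)"
  proof (rule transpI)
    fix a b c assume "a - b \<in> ideal_generated S" "b - c \<in> ideal_generated S"
    from ideal_generated_add[OF this] show "a - c \<in> ideal_generated S" by simp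
  qed
qed

lemma ideal_generated_cong_add:
  assumes "a - a' \<in> ideal_generated S" "b - b' \<in> ideal_generated S"
  shows "(a + b) - (a' + b') \<in> ideal_generated S"
  using ideal_generated_add[OF assms] by (simp add: algebra_simps)

lemma ideal_generated_cong_diff:
  assumes "a - a' \<in> ideal_generated S" "b - b' \<in> ideal_generated S"
  shows "(a - b) - (a' - b') \<in> ideal_generated S"
  using ideal_generated.diff[OF assms] by (simp add: algebra_simps)

lemma ideal_generated_cong_uminus:
  assumes "a - a' \<in> ideal_generated S"
  shows "(- a) - (- a') \<in> ideal_generated S"
  using ideal_generated_uminus[OF assms] by (simp add: algebra_simps)

lemma ideal_generated_cong_mult:
  assumes "a - a' \<in> ideal_generated S" "b - b' \<in> ideal_generated S"
  shows "a * b - a' * b' \<in> ideal_generated S"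
proof -
  have "a * b - a' * b' = (a - a') * b + a' * (b - b')" by (simp add: algebra_simps)
  then show ?thesis
    using assms ideal_generated_add ideal_generated.mult_left ideal_generated.mult_right by metis
qed

datatype 'a word = Word (letters: "'a list")

instantiation word :: (type) monoid_add
begin

definition zero_word :: "'a word" where "0 = Word []"

definition plus_word :: "'a word \<Rightarrow> 'a word \<Rightarrow> 'a word"
  where "v + w = Word (letters v @ letters w)"

instance
  by standard (auto simp: zero_word_def plus_word_def)

end

text \<open>
  \<^typ>\<open>'a word \<Rightarrow>\<^sub>0 real\<close>, the algebra of the free monoid of words, is the free unital real
  algebra on \<^typ>\<open>'a\<close>. The tensor algebra of a real vector space is its quotient by the relations
  that make the generators depend linearly on the vectors.
\<close>

abbreviation letter :: "'a \<Rightarrow> 'a word \<Rightarrow>\<^sub>0 real"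
  where "letter z \<equiv> Poly_Mapping.single (Word [z]) 1"

abbreviation const_poly :: "real \<Rightarrow> 'a word \<Rightarrow>\<^sub>0 real"
  where "const_poly r \<equiv> Poly_Mapping.single 0 r"

lemma const_poly_commute: "const_poly r * p = p * const_poly r"
proof (induction p rule: update_induct)
  case const
  show ?case by simp
next
  case (update f a b)
  have "Poly_Mapping.update a b f = f + Poly_Mapping.single a b"
    using update(1) by (intro poly_mapping_eqI)
      (auto simp: lookup_update lookup_add lookup_single when_def in_keys_iff)
  then show ?case using update
    by (simp add: algebra_simps mult_single)
qed

definition linear_relations :: "('z::real_vector word \<Rightarrow>\<^sub>0 real) set" where
  "linear_relations =
     {letter (z + w) - (letter z + letter w) | z w. True} \<union>
     {letter (r *\<^sub>R z) - const_poly r * letter z | r z. True}"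

quotient_type (overloaded) 'z tensor_algebra = "'z::real_vector word \<Rightarrow>\<^sub>0 real" /
  "\<lambda>a b. a - b \<in> ideal_generated linear_relations"
  by (rule ideal_generated_equivp)

instantiation tensor_algebra :: (real_vector) "{real_algebra, monoid_mult}"
begin

lift_definition zero_tensor_algebra :: "'a tensor_algebra" is 0 .
lift_definition one_tensor_algebra :: "'a tensor_algebra" is 1 .
lift_definition plus_tensor_algebra :: "'a tensor_algebra \<Rightarrow> 'a tensor_algebra \<Rightarrow> 'a tensor_algebra"
  is "(+)" by (rule ideal_generated_cong_add)
lift_definition minus_tensor_algebra :: "'a tensor_algebra \<Rightarrow> 'a tensor_algebra \<Rightarrow> 'a tensor_algebra"
  is "(-)" by (rule ideal_generated_cong_diff)
lift_definition uminus_tensor_algebra :: "'a tensor_algebra \<Rightarrow> 'a tensor_algebra"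
  is uminus by (rule ideal_generated_cong_uminus)
lift_definition times_tensor_algebra :: "'a tensor_algebra \<Rightarrow> 'a tensor_algebra \<Rightarrow> 'a tensor_algebra"
  is "(*)" by (rule ideal_generated_cong_mult)
lift_definition scaleR_tensor_algebra :: "real \<Rightarrow> 'a tensor_algebra \<Rightarrow> 'a tensor_algebra"
  is "\<lambda>r p. const_poly r * p"
  by (metis ideal_generated.mult_left right_diff_distrib)

instance
proof
  fix a b c :: "'a tensor_algebra" and r s :: real
  show "a + b + c = a + (b + c)"
    by transfer (simp add: add.assoc ideal_generated.zero)
  show "a + b = b + a"
    by transfer (simp add: add.commute ideal_generated.zero)
  show "0 + a = a"
    by transfer (simp add: ideal_generated.zero)
  show "- a + a = 0"
    by transfer (simp add: ideal_generated.zero)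
  show "a - b = a + - b"
    by transfer (simp add: ideal_generated.zero)
  show "a * b * c = a * (b * c)"
    by transfer (simp add: mult.assoc ideal_generated.zero)
  show "(a + b) * c = a * c + b * c"
    by transfer (simp add: distrib_right ideal_generated.zero)
  show "a * (b + c) = a * b + a * c"
    by transfer (simp add: distrib_left ideal_generated.zero)
  show "1 * a = a"
    by transfer (simp add: ideal_generated.zero)
  show "a * 1 = a"
    by transfer (simp add: ideal_generated.zero)
  show "r *\<^sub>R (a + b) = r *\<^sub>R a + r *\<^sub>R b"
    by transfer (simp add: distrib_left ideal_generated.zero)
  show "(r + s) *\<^sub>R a = r *\<^sub>R a + s *\<^sub>R a"
    by transfer (simp add: single_add distrib_right ideal_generated.zero)
  show "r *\<^sub>R s *\<^sub>R a = (r * s) *\<^sub>R a"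
    by transfer (simp add: mult.assoc[symmetric] mult_single ideal_generated.zero)
  show "1 *\<^sub>R a = a"
    by transfer (simp add: ideal_generated.zero)
  show "r *\<^sub>R a * b = r *\<^sub>R (a * b)"
    by transfer (simp add: mult.assoc ideal_generated.zero)
  show "a * r *\<^sub>R b = r *\<^sub>R (a * b)"
  proof transfer
    fix r and a b :: "'a word \<Rightarrow>\<^sub>0 real"
    have "a * (const_poly r * b) = const_poly r * (a * b)"
      by (metis const_poly_commute mult.assoc)
    then show "a * (const_poly r * b) - const_poly r * (a * b)
        \<in> ideal_generated linear_relations"
      by (simp add: ideal_generated.zero)
  qed
qed

end

lift_definition tensor_vec :: "'z::real_vector \<Rightarrow> 'z tensor_algebra" is letter .

definition clifford_relations :: "'z::real_inner tensor_algebra set" where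
  "clifford_relations =
     {tensor_vec z * tensor_vec w + tensor_vec w * tensor_vec z + (2 * (z \<bullet> w)) *\<^sub>R 1 | z w. True}"

quotient_type (overloaded) 'z clifford = "'z::real_inner tensor_algebra" /
  "\<lambda>a b. a - b \<in> ideal_generated clifford_relations"
  by (rule ideal_generated_equivp)

instantiation clifford :: (real_inner) "{real_algebra, monoid_mult}"
begin

lift_definition zero_clifford :: "'a clifford" is 0 .
lift_definition one_clifford :: "'a clifford" is 1 .
lift_definition plus_clifford :: "'a clifford \<Rightarrow> 'a clifford \<Rightarrow> 'a clifford"
  is "(+)" by (rule ideal_generated_cong_add)
lift_definition minus_clifford :: "'a clifford \<Rightarrow> 'a clifford \<Rightarrow> 'a clifford"
  is "(-)" by (rule ideal_generated_cong_diff)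
lift_definition uminus_clifford :: "'a clifford \<Rightarrow> 'a clifford"
  is uminus by (rule ideal_generated_cong_uminus)
lift_definition times_clifford :: "'a clifford \<Rightarrow> 'a clifford \<Rightarrow> 'a clifford"
  is "(*)" by (rule ideal_generated_cong_mult)
lift_definition scaleR_clifford :: "real \<Rightarrow> 'a clifford \<Rightarrow> 'a clifford"
  is "scaleR"
proof -
  fix r :: real and a b :: "'a tensor_algebra"
  assume "a - b \<in> ideal_generated clifford_relations"
  then have "(r *\<^sub>R 1) * (a - b) \<in> ideal_generated clifford_relations"
    by (rule ideal_generated.mult_left)
  then show "r *\<^sub>R a - r *\<^sub>R b \<in> ideal_generated clifford_relations"
    by (simp add: scaleR_diff_right)
qed

instance
proof
  fix a b c :: "'a clifford" and r s :: real
  show "a + b + c = a + (b + c)"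
    by transfer (simp add: add.assoc ideal_generated.zero)
  show "a + b = b + a"
    by transfer (simp add: add.commute ideal_generated.zero)
  show "0 + a = a"
    by transfer (simp add: ideal_generated.zero)
  show "- a + a = 0"
    by transfer (simp add: ideal_generated.zero)
  show "a - b = a + - b"
    by transfer (simp add: ideal_generated.zero)
  show "a * b * c = a * (b * c)"
    by transfer (simp add: mult.assoc ideal_generated.zero)
  show "(a + b) * c = a * c + b * c"
    by transfer (simp add: distrib_right ideal_generated.zero)
  show "a * (b + c) = a * b + a * c"
    by transfer (simp add: distrib_left ideal_generated.zero)
  show "1 * a = a"
    by transfer (simp add: ideal_generated.zero)
  show "a * 1 = a"
    by transfer (simp add: ideal_generated.zero)
  show "r *\<^sub>R (a + b) = r *\<^sub>R a + r *\<^sub>R b"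
    by transfer (simp add: scaleR_add_right ideal_generated.zero)
  show "(r + s) *\<^sub>R a = r *\<^sub>R a + s *\<^sub>R a"
    by transfer (simp add: scaleR_add_left ideal_generated.zero)
  show "r *\<^sub>R s *\<^sub>R a = (r * s) *\<^sub>R a"
    by transfer (simp add: ideal_generated.zero)
  show "1 *\<^sub>R a = a"
    by transfer (simp add: ideal_generated.zero)
  show "r *\<^sub>R a * b = r *\<^sub>R (a * b)"
    by transfer (simp add: ideal_generated.zero)
  show "a * r *\<^sub>R b = r *\<^sub>R (a * b)"
    by transfer (simp add: ideal_generated.zero)
qed

end

lift_definition clifford_vec :: "'z::real_inner \<Rightarrow> 'z clifford" is tensor_vec .

text \<open>The complexification \<open>\<complex> \<otimes> A\<close> of a real algebra: \<open>Cplx a b\<close> is \<open>1 \<otimes> a + i \<otimes> b\<close>.\<close>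

datatype 'a complexified = Cplx (re_part: 'a) (im_part: 'a)

instantiation complexified :: ("{real_algebra, monoid_mult}") "{real_algebra, monoid_mult}"
begin

definition "0 = Cplx 0 0"
definition "1 = Cplx 1 0"
definition "a + b = Cplx (re_part a + re_part b) (im_part a + im_part b)"
definition "a - b = Cplx (re_part a - re_part b) (im_part a - im_part b)"
definition "- a = Cplx (- re_part a) (- im_part a)"
definition "a * b = Cplx (re_part a * re_part b - im_part a * im_part b)
                         (re_part a * im_part b + im_part a * re_part b)"
definition "r *\<^sub>R a = Cplx (r *\<^sub>R re_part a) (r *\<^sub>R im_part a)"

instance
  by standard (auto simp: zero_complexified_def one_complexified_def plus_complexified_def
      minus_complexified_def uminus_complexified_def times_complexified_def
      scaleR_complexified_def algebra_simps)

end

definition cscale_complexified :: "complex \<Rightarrow> 'a::real_vector complexified \<Rightarrow> 'a complexified" where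
  "cscale_complexified c a =
     Cplx (Re c *\<^sub>R re_part a - Im c *\<^sub>R im_part a) (Re c *\<^sub>R im_part a + Im c *\<^sub>R re_part a)"

definition complexify :: "'a::zero \<Rightarrow> 'a complexified" where
  "complexify a = Cplx a 0"


section \<open>Representations\<close>

text \<open>
  Representations act on a subset \<open>V\<close> of a real inner product space; operators are functions of
  which only the values on \<open>V\<close> matter.
\<close>

locale real_hilbert_space_on =
  fixes V :: "'h::real_inner set"
  assumes subspace: "subspace V"
    and complete: "complete V"
    and separable: "\<exists>D. countable D \<and> D \<subseteq> V \<and> V \<subseteq> closure D"

text \<open>
  A complex Hilbert space whose underlying real Hilbert space is \<open>V\<close>, given by its complex scalar
  multiplication and its hermitian inner product (linear in the first argument).
\<close>

locale complex_hilbert_space_on = real_hilbert_space_on V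
  for V :: "'h::real_inner set" +
  fixes scaleC :: "complex \<Rightarrow> 'h \<Rightarrow> 'h"
    and herm :: "'h \<Rightarrow> 'h \<Rightarrow> complex"
  assumes scaleC_closed: "v \<in> V \<Longrightarrow> scaleC c v \<in> V"
    and scaleC_add_right: "u \<in> V \<Longrightarrow> v \<in> V \<Longrightarrow> scaleC c (u + v) = scaleC c u + scaleC c v"
    and scaleC_add_left: "v \<in> V \<Longrightarrow> scaleC (c + d) v = scaleC c v + scaleC d v"
    and scaleC_scaleC: "v \<in> V \<Longrightarrow> scaleC c (scaleC d v) = scaleC (c * d) v"
    and scaleC_of_real: "v \<in> V \<Longrightarrow> scaleC (of_real r) v = r *\<^sub>R v"
    and herm_add_left: "u \<in> V \<Longrightarrow> v \<in> V \<Longrightarrow> w \<in> V \<Longrightarrow> herm (u + v) w = herm u w + herm v w"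
    and herm_scaleC_left: "u \<in> V \<Longrightarrow> v \<in> V \<Longrightarrow> herm (scaleC c u) v = c * herm u v"
    and herm_commute: "u \<in> V \<Longrightarrow> v \<in> V \<Longrightarrow> herm v u = cnj (herm u v)"
    and Re_herm: "u \<in> V \<Longrightarrow> v \<in> V \<Longrightarrow> Re (herm u v) = u \<bullet> v"

text \<open>
  The last assumption of the next two locales says that the real linear map from \<open>Z\<close> to bounded
  operators is continuous.
\<close>

locale real_clifford_rep = real_hilbert_space_on V
  for V :: "'h::real_inner set" +
  fixes \<rho> :: "'z::real_inner clifford \<Rightarrow> 'h \<Rightarrow> 'h"
  assumes closed: "v \<in> V \<Longrightarrow> \<rho> a v \<in> V"
    and op_add: "u \<in> V \<Longrightarrow> v \<in> V \<Longrightarrow> \<rho> a (u + v) = \<rho> a u + \<rho> a v"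
    and op_scaleR: "v \<in> V \<Longrightarrow> \<rho> a (r *\<^sub>R v) = r *\<^sub>R \<rho> a v"
    and rep_add: "v \<in> V \<Longrightarrow> \<rho> (a + b) v = \<rho> a v + \<rho> b v"
    and rep_scaleR: "v \<in> V \<Longrightarrow> \<rho> (r *\<^sub>R a) v = r *\<^sub>R \<rho> a v"
    and rep_one: "v \<in> V \<Longrightarrow> \<rho> 1 v = v"
    and rep_mult: "v \<in> V \<Longrightarrow> \<rho> (a * b) v = \<rho> a (\<rho> b v)"
    and skew: "u \<in> V \<Longrightarrow> v \<in> V \<Longrightarrow> \<rho> (clifford_vec z) u \<bullet> v = - (u \<bullet> \<rho> (clifford_vec z) v)"
    and continuous: "\<exists>K. \<forall>z. \<forall>v\<in>V. norm (\<rho> (clifford_vec z) v) \<le> K * norm z * norm v"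

locale complex_clifford_rep = complex_hilbert_space_on V scaleC herm
  for V :: "'h::real_inner set" and scaleC herm +
  fixes \<Phi> :: "'z::real_inner clifford complexified \<Rightarrow> 'h \<Rightarrow> 'h"
  assumes closed: "v \<in> V \<Longrightarrow> \<Phi> a v \<in> V"
    and op_add: "u \<in> V \<Longrightarrow> v \<in> V \<Longrightarrow> \<Phi> a (u + v) = \<Phi> a u + \<Phi> a v"
    and op_scaleC: "v \<in> V \<Longrightarrow> \<Phi> a (scaleC c v) = scaleC c (\<Phi> a v)"
    and rep_add: "v \<in> V \<Longrightarrow> \<Phi> (a + b) v = \<Phi> a v + \<Phi> b v"
    and rep_scaleC: "v \<in> V \<Longrightarrow> \<Phi> (cscale_complexified c a) v = scaleC c (\<Phi> a v)"
    and rep_one: "v \<in> V \<Longrightarrow> \<Phi> 1 v = v"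
    and rep_mult: "v \<in> V \<Longrightarrow> \<Phi> (a * b) v = \<Phi> a (\<Phi> b v)"
    and skew: "u \<in> V \<Longrightarrow> v \<in> V \<Longrightarrow>
      herm (\<Phi> (complexify (clifford_vec z)) u) v = - herm u (\<Phi> (complexify (clifford_vec z)) v)"
    and continuous: "\<exists>K. \<forall>z. \<forall>v\<in>V.
      norm (\<Phi> (complexify (clifford_vec z)) v) \<le> K * norm z * norm v"

definition invariant_under :: "('a \<Rightarrow> 'h \<Rightarrow> 'h) \<Rightarrow> 'h set \<Rightarrow> bool" where
  "invariant_under \<pi> W \<longleftrightarrow> (\<forall>a. \<forall>w\<in>W. \<pi> a w \<in> W)"

definition irreducible_real :: "'h::real_inner set \<Rightarrow> ('a \<Rightarrow> 'h \<Rightarrow> 'h) \<Rightarrow> bool" where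
  "irreducible_real V \<rho> \<longleftrightarrow>
     (\<forall>W. W \<subseteq> V \<and> closed W \<and> subspace W \<and> invariant_under \<rho> W \<longrightarrow> W = {0} \<or> W = V)"

definition irreducible_complex ::
  "'h::real_inner set \<Rightarrow> (complex \<Rightarrow> 'h \<Rightarrow> 'h) \<Rightarrow> ('a \<Rightarrow> 'h \<Rightarrow> 'h) \<Rightarrow> bool" where
  "irreducible_complex V scaleC \<Phi> \<longleftrightarrow>
     (\<forall>W. W \<subseteq> V \<and> closed W \<and> subspace W \<and> (\<forall>c. \<forall>w\<in>W. scaleC c w \<in> W) \<and>
        invariant_under \<Phi> W \<longrightarrow> W = {0} \<or> W = V)"

definition restrict_to_real ::
  "('z::real_inner clifford complexified \<Rightarrow> 'h \<Rightarrow> 'h) \<Rightarrow> 'z clifford \<Rightarrow> 'h \<Rightarrow> 'h" where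
  "restrict_to_real \<Phi> a = \<Phi> (complexify a)"

text \<open>
  By \<^term>\<open>complex_hilbert_space_on\<close>, the complex space has \<open>V\<close> with its given inner product as
  its underlying real Hilbert space.
\<close>

definition arises_by_restriction_of_scalars ::
  "'h::real_inner set \<Rightarrow> ('z::real_inner clifford \<Rightarrow> 'h \<Rightarrow> 'h) \<Rightarrow> bool" where
  "arises_by_restriction_of_scalars V \<rho> \<longleftrightarrow>
     (\<exists>scaleC herm \<Phi>. complex_clifford_rep V scaleC herm \<Phi> \<and>
        (\<forall>a. \<forall>v\<in>V. restrict_to_real \<Phi> a v = \<rho> a v))"


section \<open>Complex structures and unitary bases\<close>

definition orthogonal_complex_structure :: "('z::real_inner \<Rightarrow> 'z) \<Rightarrow> bool" where
  "orthogonal_complex_structure \<sigma> \<longleftrightarrow> orthogonal_transformation \<sigma> \<and> (\<forall>z. \<sigma> (\<sigma> z) = - z)"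

text \<open>The hermitian inner product of \<open>(Z, \<sigma>)\<close>, where \<open>i\<close> acts by \<open>\<sigma>\<close>, linear in the first argument.\<close>

definition hermitian_form :: "('z::real_inner \<Rightarrow> 'z) \<Rightarrow> 'z \<Rightarrow> 'z \<Rightarrow> complex" where
  "hermitian_form \<sigma> u v = Complex (u \<bullet> v) (u \<bullet> \<sigma> v)"

text \<open>Basis is meant in the Hilbert space sense; the real span below is the complex span of the \<open>e k\<close>.\<close>

definition unitary_basis :: "('z::real_inner \<Rightarrow> 'z) \<Rightarrow> (nat \<Rightarrow> 'z) \<Rightarrow> bool" where
  "unitary_basis \<sigma> e \<longleftrightarrow>
     (\<forall>j k. hermitian_form \<sigma> (e j) (e k) = (if j = k then 1 else 0)) \<and>
     closure (span (range e \<union> range (\<lambda>k. \<sigma> (e k)))) = UNIV"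


section \<open>The compact group $X$ and its Haar measure\<close>

text \<open>
  All sequences are indexed from 0: \<open>x k\<close> stands for the \<open>(k+1)\<close>-st entry of \<open>x\<close>, and similarly for
  \<open>\<delta> k\<close>, \<open>c k\<close> and the basis vectors. \<^const>\<open>True\<close> is the entry 1. The topology of
  \<^typ>\<open>nat \<Rightarrow> bool\<close> in the library is the product of the discrete topologies.
\<close>

type_synonym cantor = "nat \<Rightarrow> bool"

definition xadd :: "cantor \<Rightarrow> cantor \<Rightarrow> cantor" (infixl "\<oplus>\<^sub>X" 65) where
  "x \<oplus>\<^sub>X y = (\<lambda>k. x k \<noteq> y k)"

definition delta :: "nat \<Rightarrow> cantor" where
  "delta k = (\<lambda>j. j = k)"

definition xcompl :: "cantor \<Rightarrow> cantor" where
  "xcompl x = (\<lambda>k. \<not> x k)"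

text \<open>
  Normalized; regularity is automatic, since \<open>X\<close> is compact and metrizable.
\<close>

definition is_haar_measure :: "cantor measure \<Rightarrow> bool" where
  "is_haar_measure M \<longleftrightarrow> sets M = sets borel \<and> prob_space M \<and>
     (\<forall>y. distr M M (\<lambda>x. y \<oplus>\<^sub>X x) = M)"

definition haar_X :: "cantor measure" where
  "haar_X = (THE M. is_haar_measure M)"

lemma xadd_commute: "x \<oplus>\<^sub>X y = y \<oplus>\<^sub>X x"
  by (auto simp: xadd_def)

instance bool :: second_countable_topology
proof
  have "open U" for U :: "bool set" by (rule open_discrete)
  then have "(open :: bool set \<Rightarrow> bool) = generate_topology UNIV"
    by (auto intro!: ext generate_topology.Basis)
  then show "\<exists>B::bool set set. countable B \<and> open = generate_topology B"
    by (intro exI[of _ UNIV]) auto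
qed

lemma sets_borel_bool: "sets (borel :: bool measure) = sets (count_space UNIV)"
  by (simp add: sets_borel_eq_count_space)

lemma measurable_xadd [measurable]:
  fixes f g :: "'a \<Rightarrow> cantor"
  assumes [measurable]: "f \<in> borel_measurable M" "g \<in> borel_measurable M"
  shows "(\<lambda>p. f p \<oplus>\<^sub>X g p) \<in> borel_measurable M"
proof (rule measurable_coordinatewise_then_product)
  fix k
  have [measurable]: "(\<lambda>p. f p k) \<in> M \<rightarrow>\<^sub>M count_space UNIV" "(\<lambda>p. g p k) \<in> M \<rightarrow>\<^sub>M count_space UNIV"
    using measurable_product_then_coordinatewise[OF assms(1), of k]
      measurable_product_then_coordinatewise[OF assms(2), of k]
    by (simp_all add: measurable_cong_sets[OF refl sets_borel_bool])
  show "(\<lambda>p. (f p \<oplus>\<^sub>X g p) k) \<in> borel_measurable M"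
    unfolding xadd_def measurable_cong_sets[OF refl sets_borel_bool] by measurable
qed

lemma haar_measure_unique:
  assumes "is_haar_measure M" "is_haar_measure N"
  shows "M = N"
proof (rule measure_eqI)
  have [simp, measurable_cong]: "sets M = sets borel" "sets N = sets borel"
    using assms by (auto simp: is_haar_measure_def)
  have [simp]: "space M = UNIV" "space N = UNIV"
    using sets_eq_imp_space_eq[of M borel] sets_eq_imp_space_eq[of N borel] by auto
  interpret M: prob_space M using assms by (simp add: is_haar_measure_def)
  interpret N: prob_space N using assms by (simp add: is_haar_measure_def)
  interpret MN: pair_sigma_finite M N ..
  show "sets M = sets N" by simp
  fix A assume "A \<in> sets M"
  then have A [measurable]: "A \<in> sets borel" by simp
  define P where "P = (\<lambda>p. fst p \<oplus>\<^sub>X snd p) -` A \<inter> space (M \<Otimes>\<^sub>M N)"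
  have P: "P \<in> sets (M \<Otimes>\<^sub>M N)"
    unfolding P_def by measurable
  have M_inv: "emeasure M ((\<lambda>x. y \<oplus>\<^sub>X x) -` A) = emeasure M A" for y
  proof -
    have "emeasure M A = emeasure (distr M M (\<lambda>x. y \<oplus>\<^sub>X x)) A"
      using assms by (simp add: is_haar_measure_def)
    also have "\<dots> = emeasure M ((\<lambda>x. y \<oplus>\<^sub>X x) -` A)"
      by (subst emeasure_distr) auto
    finally show ?thesis by simp
  qed
  have N_inv: "emeasure N ((\<lambda>x. y \<oplus>\<^sub>X x) -` A) = emeasure N A" for y
  proof -
    have "emeasure N A = emeasure (distr N N (\<lambda>x. y \<oplus>\<^sub>X x)) A"
      using assms by (simp add: is_haar_measure_def)
    also have "\<dots> = emeasure N ((\<lambda>x. y \<oplus>\<^sub>X x) -` A)"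
      by (subst emeasure_distr) auto
    finally show ?thesis by simp
  qed
  have "emeasure (M \<Otimes>\<^sub>M N) P = (\<integral>\<^sup>+x. emeasure N (Pair x -` P) \<partial>M)"
    by (rule N.emeasure_pair_measure_alt[OF P])
  also have "\<dots> = (\<integral>\<^sup>+x. emeasure N ((\<lambda>y. x \<oplus>\<^sub>X y) -` A) \<partial>M)"
    by (intro nn_integral_cong arg_cong[where f = "emeasure N"])
       (auto simp: P_def space_pair_measure)
  finally have 1: "emeasure (M \<Otimes>\<^sub>M N) P = emeasure N A"
    by (simp add: N_inv M.emeasure_space_1[simplified])
  have "emeasure (M \<Otimes>\<^sub>M N) P = (\<integral>\<^sup>+y. emeasure M ((\<lambda>x. (x, y)) -` P) \<partial>N)"
    by (rule MN.emeasure_pair_measure_alt2[OF P])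
  also have "\<dots> = (\<integral>\<^sup>+y. emeasure M ((\<lambda>x. y \<oplus>\<^sub>X x) -` A) \<partial>N)"
    by (intro nn_integral_cong arg_cong[where f = "emeasure M"])
       (auto simp: P_def space_pair_measure xadd_commute)
  finally have 2: "emeasure (M \<Otimes>\<^sub>M N) P = emeasure M A"
    by (simp add: M_inv N.emeasure_space_1[simplified])
  show "emeasure M A = emeasure N A" using 1 2 by simp
qed

lemma haar_measure_fair_coins: "is_haar_measure (PiM UNIV (\<lambda>_. uniform_count_measure UNIV))"
  (is "is_haar_measure ?P")
proof -
  let ?B = "uniform_count_measure (UNIV :: bool set)"
  interpret B: prob_space ?B by (rule prob_space_uniform_count_measure) auto
  interpret product_prob_space "\<lambda>_. ?B" "UNIV :: nat set" ..
  have sets_P [measurable_cong]: "sets ?P = sets borel"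
    unfolding sets_PiM_equal_borel[symmetric]
    by (rule sets_PiM_cong) (simp_all add: sets_borel_bool sets_uniform_count_measure)
  have sp [simp]: "space ?P = UNIV" using sets_eq_imp_space_eq[OF sets_P] by simp
  have "distr ?P ?P (\<lambda>x. y \<oplus>\<^sub>X x) = ?P" for y
  proof (rule PiM_eq)
    show "sets (distr ?P ?P (\<lambda>x. y \<oplus>\<^sub>X x)) = sets ?P" by simp
    fix J :: "nat set" and F :: "nat \<Rightarrow> bool set"
    assume J: "finite J" and F: "\<And>j. j \<in> J \<Longrightarrow> F j \<in> sets ?B"
    define F' where "F' j = {b. (y j \<noteq> b) \<in> F j}" for j
    have emb: "prod_emb UNIV (\<lambda>_. ?B) J (Pi\<^sub>E J F) \<in> sets ?P"
      using J F by (intro sets_PiM_I) auto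
    have "emeasure (distr ?P ?P (\<lambda>x. y \<oplus>\<^sub>X x)) (prod_emb UNIV (\<lambda>_. ?B) J (Pi\<^sub>E J F)) =
        emeasure ?P ((\<lambda>x. y \<oplus>\<^sub>X x) -` prod_emb UNIV (\<lambda>_. ?B) J (Pi\<^sub>E J F) \<inter> space ?P)"
      by (rule emeasure_distr[OF _ emb]) measurable
    also have "(\<lambda>x. y \<oplus>\<^sub>X x) -` prod_emb UNIV (\<lambda>_. ?B) J (Pi\<^sub>E J F) \<inter> space ?P =
        prod_emb UNIV (\<lambda>_. ?B) J (Pi\<^sub>E J F')"
      by (auto simp: prod_emb_def xadd_def F'_def PiE_iff space_uniform_count_measure)
    also have "emeasure ?P \<dots> = (\<Prod>j\<in>J. emeasure ?B (F' j))"
      using J by (intro emeasure_PiM_emb) (auto simp: sets_uniform_count_measure)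
    also have "\<dots> = (\<Prod>j\<in>J. emeasure ?B (F j))"
    proof (rule prod.cong)
      fix j
      have "bij_betw (\<lambda>b. y j \<noteq> b) (F' j) (F j)"
        by (rule bij_betw_byWitness[where f' = "\<lambda>b. y j \<noteq> b"]; cases "y j") (auto simp: F'_def)
      then have "card (F' j) = card (F j)" by (rule bij_betw_same_card)
      then show "emeasure ?B (F' j) = emeasure ?B (F j)"
        by (simp add: emeasure_uniform_count_measure)
    qed simp
    finally show "emeasure (distr ?P ?P (\<lambda>x. y \<oplus>\<^sub>X x)) (prod_emb UNIV (\<lambda>_. ?B) J (Pi\<^sub>E J F)) =
        (\<Prod>j\<in>J. emeasure ?B (F j))" .
  qed
  then show ?thesis
    using sets_P P.prob_space_axioms by (auto simp: is_haar_measure_def)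
qed

lemma ex1_haar_measure: "\<exists>!M. is_haar_measure M"
  using haar_measure_unique haar_measure_fair_coins by blast

lemma is_haar_measure_haar_X: "is_haar_measure haar_X"
  unfolding haar_X_def by (rule theI'[OF ex1_haar_measure])


section \<open>The Hilbert space $L_2(X)$\<close>

definition square_integrable :: "(cantor \<Rightarrow> complex) \<Rightarrow> bool" where
  "square_integrable f \<longleftrightarrow>
     f \<in> borel_measurable haar_X \<and> integrable haar_X (\<lambda>x. (cmod (f x))\<^sup>2)"

lemma borel_measurable_cnj [measurable]:
  "f \<in> borel_measurable M \<Longrightarrow> (\<lambda>x. cnj (f x)) \<in> borel_measurable M"
  by (rule borel_measurable_continuous_on[OF continuous_on_cnj[OF continuous_on_id]])

lemma square_integrable_mult:
  assumes "square_integrable f" "square_integrable g"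
  shows "integrable haar_X (\<lambda>x. f x * cnj (g x))"
proof -
  have [measurable]: "f \<in> borel_measurable haar_X" "g \<in> borel_measurable haar_X"
    using assms by (auto simp: square_integrable_def)
  have *: "integrable haar_X (\<lambda>x. (cmod (f x))\<^sup>2 + (cmod (g x))\<^sup>2)"
    using assms by (auto simp: square_integrable_def)
  have bound: "cmod a * cmod b \<le> (cmod a)\<^sup>2 + (cmod b)\<^sup>2" for a b
  proof -
    have "2 * (cmod a * cmod b) \<le> (cmod a)\<^sup>2 + (cmod b)\<^sup>2"
      using sum_squares_bound[of "cmod a" "cmod b"] by (simp add: mult.assoc)
    moreover have "0 \<le> cmod a * cmod b" by simp
    ultimately show ?thesis by linarith
  qed
  show ?thesis
    by (rule Bochner_Integration.integrable_bound[OF *])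
       (auto simp: norm_mult bound intro!: AE_I2)
qed

lemma square_integrable_add:
  assumes "square_integrable f" "square_integrable g"
  shows "square_integrable (\<lambda>x. f x + g x)"
proof -
  have [measurable]: "f \<in> borel_measurable haar_X" "g \<in> borel_measurable haar_X"
    using assms by (auto simp: square_integrable_def)
  have *: "integrable haar_X (\<lambda>x. 2 * (cmod (f x))\<^sup>2 + 2 * (cmod (g x))\<^sup>2)"
    using assms by (auto simp: square_integrable_def)
  have bound: "(cmod (a + b))\<^sup>2 \<le> 2 * (cmod a)\<^sup>2 + 2 * (cmod b)\<^sup>2" for a b
  proof -
    have "(cmod (a + b))\<^sup>2 \<le> (cmod a + cmod b)\<^sup>2"
      by (simp add: norm_triangle_ineq power_mono)
    also have "\<dots> \<le> 2 * (cmod a)\<^sup>2 + 2 * (cmod b)\<^sup>2"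
      using sum_squares_bound[of "cmod a" "cmod b"] by (simp add: power2_sum)
    finally show ?thesis .
  qed
  have "integrable haar_X (\<lambda>x. (cmod (f x + g x))\<^sup>2)"
    by (rule Bochner_Integration.integrable_bound[OF *])
       (auto simp: bound intro!: AE_I2)
  then show ?thesis by (simp add: square_integrable_def)
qed

lemma square_integrable_cmult:
  assumes "square_integrable f"
  shows "square_integrable (\<lambda>x. c * f x)"
  using assms by (auto simp: square_integrable_def norm_mult power_mult_distrib)

quotient_type L2X = "cantor \<Rightarrow> complex" / partial:
  "\<lambda>f g. square_integrable f \<and> square_integrable g \<and> (AE x in haar_X. f x = g x)"
proof (rule part_equivpI)
  show "\<exists>f. square_integrable f \<and> square_integrable f \<and> (AE x in haar_X. f x = f x)"
    by (rule exI[of _ "\<lambda>_. 0"]) (simp add: square_integrable_def)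
  show "symp (\<lambda>f g. square_integrable f \<and> square_integrable g \<and> (AE x in haar_X. f x = g x))"
    by (rule sympI) (auto elim: AE_mp)
  show "transp (\<lambda>f g. square_integrable f \<and> square_integrable g \<and> (AE x in haar_X. f x = g x))"
    by (rule transpI) auto
qed

text \<open>A representative of a class; it is determined up to a null set.\<close>

definition fun_of :: "L2X \<Rightarrow> cantor \<Rightarrow> complex" where
  "fun_of F = rep_L2X F"

lift_definition herm_L2X :: "L2X \<Rightarrow> L2X \<Rightarrow> complex" is
  "\<lambda>f g. \<integral>x. f x * cnj (g x) \<partial>haar_X"
proof -
  fix f f' g g'
  assume *: "square_integrable f \<and> square_integrable f' \<and> (AE x in haar_X. f x = f' x)"
    "square_integrable g \<and> square_integrable g' \<and> (AE x in haar_X. g x = g' x)"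
  have [measurable]: "f \<in> borel_measurable haar_X" "g \<in> borel_measurable haar_X"
    "f' \<in> borel_measurable haar_X" "g' \<in> borel_measurable haar_X"
    using * by (auto simp: square_integrable_def)
  show "(\<integral>x. f x * cnj (g x) \<partial>haar_X) = (\<integral>x. f' x * cnj (g' x) \<partial>haar_X)"
    using * by (intro integral_cong_AE) auto
qed

lift_definition scaleC_L2X :: "complex \<Rightarrow> L2X \<Rightarrow> L2X" is "\<lambda>c f x. c * f x"
  by (auto simp: square_integrable_cmult)

instantiation L2X :: real_vector
begin

lift_definition zero_L2X :: L2X is "\<lambda>_. 0"
  by (simp add: square_integrable_def)

lift_definition plus_L2X :: "L2X \<Rightarrow> L2X \<Rightarrow> L2X" is "\<lambda>f g x. f x + g x"
  by (auto simp: square_integrable_add)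

definition uminus_L2X :: "L2X \<Rightarrow> L2X" where "- F = scaleC_L2X (-1) F"

definition minus_L2X :: "L2X \<Rightarrow> L2X \<Rightarrow> L2X" where "F - G = F + - (G::L2X)"

definition scaleR_L2X :: "real \<Rightarrow> L2X \<Rightarrow> L2X" where "r *\<^sub>R F = scaleC_L2X (of_real r) F"

instance
proof
  fix F G H :: L2X and r s :: real
  show "F + G + H = F + (G + H)"
    by transfer (auto simp: square_integrable_add add.assoc)
  show comm: "F + G = G + F" for F G :: L2X
    by transfer (auto simp: square_integrable_add add.commute)
  show "0 + F = F"
    by transfer auto
  show "- F + F = 0"
    unfolding uminus_L2X_def
  proof transfer
    fix f assume "square_integrable f \<and> square_integrable f \<and> (AE x in haar_X. f x = f x)"
    then show "square_integrable (\<lambda>x. - 1 * f x + f x) \<and> square_integrable (\<lambda>_. 0) \<and>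
        (AE x in haar_X. - 1 * f x + f x = 0)"
      by (simp add: square_integrable_def)
  qed
  show "F - G = F + - G" by (rule minus_L2X_def)
  show "r *\<^sub>R (F + G) = r *\<^sub>R F + r *\<^sub>R G"
    unfolding scaleR_L2X_def
    by transfer (auto simp only: square_integrable_add square_integrable_cmult distrib_left)
  show "(r + s) *\<^sub>R F = r *\<^sub>R F + s *\<^sub>R F"
    unfolding scaleR_L2X_def of_real_add
    by transfer (auto simp only: square_integrable_add square_integrable_cmult distrib_right)
  show "r *\<^sub>R s *\<^sub>R F = (r * s) *\<^sub>R F"
    unfolding scaleR_L2X_def of_real_mult
    by transfer (auto simp: square_integrable_cmult mult.assoc)
  show "1 *\<^sub>R F = F"
    unfolding scaleR_L2X_def of_real_1 by transfer simp
qed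

end

instantiation L2X :: real_inner
begin

definition inner_L2X :: "L2X \<Rightarrow> L2X \<Rightarrow> real" where "F \<bullet> G = Re (herm_L2X F G)"

definition norm_L2X :: "L2X \<Rightarrow> real" where "norm F = sqrt (F \<bullet> (F::L2X))"

definition dist_L2X :: "L2X \<Rightarrow> L2X \<Rightarrow> real" where "dist F G = norm (F - (G::L2X))"

definition sgn_L2X :: "L2X \<Rightarrow> L2X" where "sgn F = F /\<^sub>R norm (F::L2X)"

definition uniformity_L2X :: "(L2X \<times> L2X) filter" where
  "uniformity_L2X = (INF e\<in>{0 <..}. principal {(F, G). dist F G < e})"

definition open_L2X :: "L2X set \<Rightarrow> bool" where
  "open_L2X U \<longleftrightarrow> (\<forall>F\<in>U. eventually (\<lambda>(F', G). F' = F \<longrightarrow> G \<in> U) uniformity)"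

instance
proof
  fix F G H :: L2X and r :: real
  show "dist F G = norm (F - G)" by (rule dist_L2X_def)
  show "sgn F = F /\<^sub>R norm F" by (rule sgn_L2X_def)
  show "uniformity = (INF e\<in>{0 <..}. principal {(F, G :: L2X). dist F G < e})"
    by (rule uniformity_L2X_def)
  show "open U \<longleftrightarrow> (\<forall>F\<in>U. eventually (\<lambda>(F', G). F' = F \<longrightarrow> G \<in> U) uniformity)"
    for U :: "L2X set" by (rule open_L2X_def)
  show "F \<bullet> G = G \<bullet> F"
    unfolding inner_L2X_def
  proof transfer
    fix f g
    assume "square_integrable f \<and> square_integrable f \<and> (AE x in haar_X. f x = f x)"
      "square_integrable g \<and> square_integrable g \<and> (AE x in haar_X. g x = g x)"
    then have int: "integrable haar_X (\<lambda>x. f x * cnj (g x))"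
      by (simp add: square_integrable_mult)
    have "(\<integral>x. g x * cnj (f x) \<partial>haar_X) = (\<integral>x. cnj (f x * cnj (g x)) \<partial>haar_X)"
      by (simp add: mult.commute)
    also have "\<dots> = cnj (\<integral>x. f x * cnj (g x) \<partial>haar_X)"
      by (rule integral_bounded_linear[OF bounded_linear_cnj int])
    finally show "Re (\<integral>x. f x * cnj (g x) \<partial>haar_X) = Re (\<integral>x. g x * cnj (f x) \<partial>haar_X)"
      by simp
  qed
  show "(F + G) \<bullet> H = F \<bullet> H + G \<bullet> H"
    unfolding inner_L2X_def
    by transfer (simp add: distrib_right square_integrable_mult)
  show "(r *\<^sub>R F) \<bullet> G = r * (F \<bullet> G)"
    unfolding inner_L2X_def scaleR_L2X_def
    by transfer (simp add: mult.assoc)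
  have self: "Re (\<integral>x. f x * cnj (f x) \<partial>haar_X) = (\<integral>x. (cmod (f x))\<^sup>2 \<partial>haar_X)" for f
    by (simp add: complex_norm_square[symmetric] flip: of_real_power)
  show "0 \<le> F \<bullet> F"
    unfolding inner_L2X_def by transfer (simp add: self)
  show "F \<bullet> F = 0 \<longleftrightarrow> F = 0"
    unfolding inner_L2X_def
  proof transfer
    fix f assume f: "square_integrable f \<and> square_integrable f \<and> (AE x in haar_X. f x = f x)"
    then have int: "integrable haar_X (\<lambda>x. (cmod (f x))\<^sup>2)" by (simp add: square_integrable_def)
    have "(\<integral>x. (cmod (f x))\<^sup>2 \<partial>haar_X) = 0 \<longleftrightarrow> (AE x in haar_X. (cmod (f x))\<^sup>2 = 0)"
      by (rule integral_nonneg_eq_0_iff_AE[OF int]) simp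
    then show "Re (\<integral>x. f x * cnj (f x) \<partial>haar_X) = 0 \<longleftrightarrow>
      square_integrable f \<and> square_integrable (\<lambda>_. 0) \<and> (AE x in haar_X. f x = 0)"
      using f by (simp add: self) (simp add: square_integrable_def)
  qed
  show "norm F = sqrt (F \<bullet> F)" by (rule norm_L2X_def)
qed

end

definition L2X_real :: "L2X set" where
  "L2X_real = {F. AE x in haar_X. fun_of F (xcompl x) = cnj (fun_of F x)}"


section \<open>The operators\<close>

text \<open>
  With indices shifted by one: the index is even iff \<open>k\<close> is odd, and the indices \<open>4 * l + 1\<close> and
  \<open>4 * l + 3\<close> become \<open>4 * l\<close> and \<open>4 * l + 2\<close>.
\<close>

definition c_fun :: "nat \<Rightarrow> cantor \<Rightarrow> complex" where
  "c_fun k x =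
     (if odd k then 1
      else if k mod 4 = 0 then (-1) ^ of_bool (x (k + 2))
      else (-1) ^ of_bool (x (k - 2)))"

definition acts_by_formulas ::
  "(nat \<Rightarrow> cantor \<Rightarrow> complex) \<Rightarrow> ('z::real_inner \<Rightarrow> 'z) \<Rightarrow> (nat \<Rightarrow> 'z) \<Rightarrow>
   ('z clifford complexified \<Rightarrow> L2X \<Rightarrow> L2X) \<Rightarrow> bool" where
  "acts_by_formulas c \<sigma> e \<Phi> \<longleftrightarrow>
     (\<forall>k F. AE x in haar_X.
        fun_of (\<Phi> (complexify (clifford_vec (e k))) F) x =
          (-1) ^ ((\<Sum>j<k. of_bool (x j)) + 1) * \<i> * c k x * fun_of F (x \<oplus>\<^sub>X delta k)) \<and>
     (\<forall>k F. AE x in haar_X.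
        fun_of (\<Phi> (complexify (clifford_vec (\<sigma> (e k)))) F) x =
          (-1) ^ of_bool (x k) * \<i> * fun_of (\<Phi> (complexify (clifford_vec (e k))) F) x)"

end

theory Submission
  imports Defs
begin

text \<open>
  Write \<open>r\<^sub>k(x) = (-1)\<^bsup>x k\<^esup>\<close> and let \<open>J\<^sub>k\<close>, \<open>K\<^sub>k\<close> be the operators prescribed for \<open>e k\<close> and
  \<open>\<sigma> (e k)\<close>. All of them have the form \<open>f \<mapsto> p \<cdot> f(\<cdot> + \<delta>\<^sub>k)\<close> with a unimodular function \<open>p\<close>, and the
  identities satisfied by the \<open>c\<^sub>k\<close> make them skew-hermitian, of square \<open>-1\<close>, and pairwise
  anticommuting.

  Existence and uniqueness: for fixed \<open>v\<close> the vectors \<open>J\<^sub>k v\<close>, \<open>K\<^sub>k v\<close> are orthogonal and have the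
  length of \<open>v\<close>, so the expansion of \<open>z \<in> Z\<close> in the real orthonormal basis \<open>e k, \<sigma> (e k)\<close> gives an
  orthogonal series for the operator of \<open>z\<close>, which has norm \<open>\<bar>z\<bar>\<close>
  (\<open>orthonormal_clifford_system\<close>; this uses the completeness of \<open>L\<^sub>2(X)\<close>). The Clifford relation
  follows by polarization, and the universal property of the Clifford algebra (\<open>clifford_action\<close>)
  extends the action to \<open>C(Z)\<close> and to its complexification. Uniqueness holds because the basis is
  total, the action is continuous on \<open>Z\<close>, and \<open>Z\<close> generates \<open>C(Z)\<close>.

  The rest depends on one fact (\<open>orbit_orthogonal_imp_zero\<close>): if \<open>\<langle>a F, G\<rangle> = 0\<close> for all \<open>a \<in> C(Z)\<close>,
  then \<open>F = 0\<close> or \<open>G = 0\<close>. Indeed, the vectors \<open>F\<close> whose orbit is orthogonal to \<open>G\<close> form a complex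
  subspace invariant under \<open>J\<^sub>k\<close> and \<open>K\<^sub>k\<close>. Now \<open>J\<^sub>k K\<^sub>k\<close> is multiplication by \<open>i r\<^sub>k\<close>, so the subspace
  is invariant under multiplication by every Walsh function \<open>w\<^sub>B = \<Prod>k\<in>B. r\<^sub>k\<close> and, since \<open>J\<^sub>k\<close>
  differs from the translation by \<open>\<delta>\<^sub>k\<close> only by a Walsh function and a scalar, under translation by every
  finitely supported sequence \<open>y\<close>. Hence all Walsh coefficients of \<open>F(\<cdot> + y) cnj G\<close> vanish, and the
  Walsh functions are complete, so for all \<open>y\<close> this product is zero almost everywhere. The union of the translates
  of \<open>{F \<noteq> 0}\<close> by the finitely supported sequences is invariant under these translations, hence
  null or conull. In the first case \<open>F = 0\<close>, in the second \<open>G = 0\<close>.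

  A closed invariant subspace containing some \<open>F \<noteq> 0\<close> has therefore no nonzero vector orthogonal to
  it. This gives the complex irreducibility, and also the real one, because the hermitian product
  is real on \<open>L\<^sub>2(X)\<^sup>\<real>\<close>. Finally, an orthogonal \<open>T\<close> on \<open>L\<^sub>2(X)\<^sup>\<real>\<close> with \<open>T\<^sup>2 = -1\<close> commuting with \<open>C(Z)\<close>
  is skew, and then the orbit of \<open>f - i T f\<close> is orthogonal to \<open>f + i T f\<close> for every \<open>f\<close>; one of the
  two vectors vanishes, and taking the product with \<open>f\<close> shows \<open>f = 0\<close>.
\<close>

section \<open>Orthogonal projections\<close>

lemma orthogonal_projection_exists:
  fixes W :: "'a::real_inner set"
  assumes "complete W" "subspace W"
  shows "\<exists>w\<in>W. \<forall>u\<in>W. (v - w) \<bullet> u = 0"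
proof -
  define d where "d = (INF w\<in>W. (norm (v - w))\<^sup>2)"
  have ne: "W \<noteq> {}" using subspace_0[OF assms(2)] by auto
  have bdd: "bdd_below ((\<lambda>w. (norm (v - w))\<^sup>2) ` W)" by (rule bdd_belowI2[of _ 0]) simp
  have d_le: "d \<le> (norm (v - w))\<^sup>2" if "w \<in> W" for w
    unfolding d_def by (rule cINF_lower[OF bdd that])
  have "\<exists>w\<in>W. (norm (v - w))\<^sup>2 < d + inverse (Suc n)" for n
    using cINF_less_iff[OF ne bdd, of "d + inverse (Suc n)"] unfolding d_def by auto
  then obtain w where w: "w n \<in> W" "(norm (v - w n))\<^sup>2 < d + inverse (Suc n)" for n by metis
  \<comment> \<open>The parallelogram law turns a minimizing sequence into a Cauchy sequence.\<close>
  have par: "(norm (w m - w n))\<^sup>2 \<le> 2 * inverse (Suc m) + 2 * inverse (Suc n)" for m n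
  proof -
    have mid: "(1/2) *\<^sub>R (w m + w n) \<in> W"
      using w assms(2) by (simp add: subspace_add subspace_scale)
    have "(norm (w m - w n))\<^sup>2 = 2 * (norm (v - w m))\<^sup>2 + 2 * (norm (v - w n))\<^sup>2
        - 4 * (norm (v - (1/2) *\<^sub>R (w m + w n)))\<^sup>2"
      unfolding power2_norm_eq_inner
      by (simp add: inner_diff_left inner_diff_right inner_add_left inner_add_right
          inner_commute algebra_simps)
    then show ?thesis using d_le[OF mid] w(2)[of m] w(2)[of n] by linarith
  qed
  have "Cauchy w"
  proof (rule metric_CauchyI)
    fix e :: real assume "0 < e"
    obtain N where N: "inverse (Suc N) < e\<^sup>2 / 4"
      using reals_Archimedean[of "e\<^sup>2 / 4"] \<open>0 < e\<close> by auto
    have "dist (w m) (w n) < e" if "m \<ge> N" "n \<ge> N" for m n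
    proof -
      have "inverse (Suc m) \<le> inverse (Suc N)" "inverse (Suc n) \<le> inverse (Suc N)"
        using that by (simp_all add: field_simps)
      then have "(norm (w m - w n))\<^sup>2 < e\<^sup>2"
        using par[of m n] N by linarith
      then show ?thesis using \<open>0 < e\<close> by (simp add: dist_norm power2_less_imp_less)
    qed
    then show "\<exists>M. \<forall>m\<ge>M. \<forall>n\<ge>M. dist (w m) (w n) < e" by blast
  qed
  then obtain l where l: "l \<in> W" "w \<longlonglongrightarrow> l"
    using assms(1) w(1) unfolding complete_def by blast
  have "(norm (v - l))\<^sup>2 \<le> d"
  proof (rule LIMSEQ_le)
    show "(\<lambda>n. (norm (v - w n))\<^sup>2) \<longlonglongrightarrow> (norm (v - l))\<^sup>2" by (intro tendsto_intros l)
    show "(\<lambda>n. d + inverse (Suc n)) \<longlonglongrightarrow> d"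
      using tendsto_add[OF tendsto_const LIMSEQ_inverse_real_of_nat, of d] by simp
    show "\<exists>N. \<forall>n\<ge>N. (norm (v - w n))\<^sup>2 \<le> d + inverse (Suc n)" using w(2) less_imp_le by blast
  qed
  then have min: "(norm (v - l))\<^sup>2 \<le> (norm (v - u))\<^sup>2" if "u \<in> W" for u
    using d_le[OF that] by linarith
  have "(v - l) \<bullet> u = 0" if u: "u \<in> W" for u
  proof (cases "u = 0")
    case False
    \<comment> \<open>The minimizer of \<open>\<bar>v - l - t u\<bar>\<close> over real \<open>t\<close>.\<close>
    define t where "t = ((v - l) \<bullet> u) / (u \<bullet> u)"
    have "l + t *\<^sub>R u \<in> W" using l u assms(2) by (simp add: subspace_add subspace_scale)
    from min[OF this] have "0 \<le> - 2 * t * ((v - l) \<bullet> u) + t\<^sup>2 * (u \<bullet> u)"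
      unfolding power2_norm_eq_inner
      by (simp add: inner_diff_left inner_diff_right inner_add_left inner_add_right
          inner_commute algebra_simps power2_eq_square)
    also have "\<dots> = - (((v - l) \<bullet> u)\<^sup>2 / (u \<bullet> u))"
      using False by (simp add: t_def field_simps power2_eq_square)
    finally have "((v - l) \<bullet> u)\<^sup>2 / (u \<bullet> u) \<le> 0" by simp
    moreover have "0 < u \<bullet> u" using False by simp
    ultimately have "((v - l) \<bullet> u)\<^sup>2 \<le> 0" by (simp add: divide_le_0_iff)
    then show ?thesis by simp
  qed simp
  then show ?thesis using l by blast
qed

section \<open>Clifford actions from anticommuting complex structures\<close>

text \<open>
  An orthonormal basis \<open>b\<close> of the inner product space \<open>Z\<close>, and a skew operator \<open>G n\<close> for each \<open>b n\<close>
  such that the Clifford relations hold for the basis vectors.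
\<close>

locale orthonormal_clifford_system =
  fixes b :: "nat \<Rightarrow> 'z::real_inner" and G :: "nat \<Rightarrow> 'h::{real_inner, banach} \<Rightarrow> 'h"
  assumes orthonormal: "b i \<bullet> b j = of_bool (i = j)"
    and total: "closure (span (range b)) = UNIV"
    and linear_G: "linear (G n)"
    and skew_G: "G n u \<bullet> v = - (u \<bullet> G n v)"
    and square_G: "G n (G n v) = - v"
    and anticommute_G: "m \<noteq> n \<Longrightarrow> G m (G n v) = - G n (G m v)"
begin

lemma norm_expansion:
  assumes "finite A"
  shows "(norm (\<Sum>i\<in>A. c i *\<^sub>R b i))\<^sup>2 = (\<Sum>i\<in>A. (c i)\<^sup>2)"
  using assms unfolding power2_norm_eq_inner
  by (simp add: inner_sum_left inner_sum_right orthonormal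
      power2_eq_square of_bool_def if_distrib[of "(*) _"] cong: if_cong)

lemma partial_sums_contract:
  "norm (y - (\<Sum>i<n. (y \<bullet> b i) *\<^sub>R b i)) \<le> norm y"
proof -
  let ?s = "\<Sum>i<n. (y \<bullet> b i) *\<^sub>R b i"
  have "(norm ?s)\<^sup>2 = (\<Sum>i<n. (y \<bullet> b i)\<^sup>2)" by (simp add: norm_expansion)
  moreover have "y \<bullet> ?s = (\<Sum>i<n. (y \<bullet> b i)\<^sup>2)" by (simp add: inner_sum_right power2_eq_square)
  ultimately have "(norm (y - ?s))\<^sup>2 = (norm y)\<^sup>2 - (norm ?s)\<^sup>2"
    unfolding power2_norm_eq_inner by (simp add: inner_diff_left inner_diff_right inner_commute)
  then have "(norm (y - ?s))\<^sup>2 \<le> (norm y)\<^sup>2" by simp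
  then show ?thesis by (rule power2_le_imp_le) simp
qed

lemma span_expansion:
  assumes "w \<in> span (range b)"
  shows "\<exists>N. \<forall>n\<ge>N. (\<Sum>i<n. (w \<bullet> b i) *\<^sub>R b i) = w"
  using assms
proof (induction rule: span_induct_alt)
  case base
  show ?case by simp
next
  case (step c x y)
  then obtain k N where k: "x = b k" and N: "\<forall>n\<ge>N. (\<Sum>i<n. (y \<bullet> b i) *\<^sub>R b i) = y" by auto
  have "(\<Sum>i<n. ((c *\<^sub>R x + y) \<bullet> b i) *\<^sub>R b i) = c *\<^sub>R x + y" if "n \<ge> max N (Suc k)" for n
  proof -
    have "(\<Sum>i<n. (c * (b k \<bullet> b i)) *\<^sub>R b i) = (\<Sum>i<n. if i = k then c *\<^sub>R b k else 0)"
      by (intro sum.cong) (auto simp: orthonormal)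
    also have "\<dots> = c *\<^sub>R b k" using that by simp
    finally show ?thesis
      using N that by (simp add: inner_add_left scaleR_add_left sum.distrib k)
  qed
  then show ?case by blast
qed

lemma expansion_sums: "(\<lambda>i. (z \<bullet> b i) *\<^sub>R b i) sums z"
  unfolding sums_def
proof (rule metric_LIMSEQ_I)
  fix e :: real assume "0 < e"
  then obtain w where w: "w \<in> span (range b)" "dist w z < e"
    using total closure_approachable[of z "span (range b)"] by auto
  obtain N where N: "\<forall>n\<ge>N. (\<Sum>i<n. (w \<bullet> b i) *\<^sub>R b i) = w" using span_expansion[OF w(1)] by blast
  have "dist (\<Sum>i<n. (z \<bullet> b i) *\<^sub>R b i) z < e" if "n \<ge> N" for n
  proof -
    have "dist (\<Sum>i<n. (z \<bullet> b i) *\<^sub>R b i) z = norm (z - (\<Sum>i<n. (z \<bullet> b i) *\<^sub>R b i))"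
      by (simp add: dist_norm norm_minus_commute)
    also have "z - (\<Sum>i<n. (z \<bullet> b i) *\<^sub>R b i) =
        (z - w) - (\<Sum>i<n. ((z - w) \<bullet> b i) *\<^sub>R b i)"
      using N that by (simp add: inner_diff_left scaleR_diff_left sum_subtractf)
    also have "norm \<dots> \<le> norm (z - w)" by (rule partial_sums_contract)
    finally show ?thesis using w(2) by (simp add: dist_norm norm_minus_commute)
  qed
  then show "\<exists>N. \<forall>n\<ge>N. dist (\<Sum>i<n. (z \<bullet> b i) *\<^sub>R b i) z < e" by blast
qed

lemma G_orthogonal: "G i v \<bullet> G j v = of_bool (i = j) * (v \<bullet> v)"
proof (cases "i = j")
  case True
  then show ?thesis using skew_G[of i v "G i v"] square_G[of i v] by simp
next
  case False
  have "G i v \<bullet> G j v = - (v \<bullet> G i (G j v))" by (rule skew_G)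
  also have "\<dots> = v \<bullet> G j (G i v)" using anticommute_G[OF False] by simp
  also have "\<dots> = - (G j v \<bullet> G i v)" using skew_G[of j v "G i v"] by simp
  finally show ?thesis using False by (simp add: inner_commute)
qed

text \<open>The vectors \<open>G i v\<close> are orthogonal and all have the length of \<open>v\<close>.\<close>

lemma norm_sum_G:
  assumes "finite A"
  shows "norm (\<Sum>i\<in>A. c i *\<^sub>R G i v) = norm (\<Sum>i\<in>A. c i *\<^sub>R b i) * norm v"
proof -
  have "(norm (\<Sum>i\<in>A. c i *\<^sub>R G i v))\<^sup>2 = (\<Sum>i\<in>A. (c i)\<^sup>2) * (v \<bullet> v)"
    using assms unfolding power2_norm_eq_inner
    by (simp add: inner_sum_left inner_sum_right G_orthogonal sum_distrib_right
      power2_eq_square of_bool_def mult.assoc if_distrib[of "(*) _"] if_distrib[of "\<lambda>x. x * _"] cong: if_cong)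
  also have "\<dots> = (norm (\<Sum>i\<in>A. c i *\<^sub>R b i) * norm v)\<^sup>2"
    using norm_expansion[OF assms] by (simp add: power_mult_distrib power2_norm_eq_inner)
  finally show ?thesis by simp
qed

text \<open>The operator by which \<open>z \<in> Z\<close> acts; the series is orthogonal and converges for every \<open>v\<close>.\<close>

definition vec_op :: "'z \<Rightarrow> 'h \<Rightarrow> 'h" where
  "vec_op z v = suminf (\<lambda>i. (z \<bullet> b i) *\<^sub>R G i v)"

lemma vec_op_sums: "(\<lambda>i. (z \<bullet> b i) *\<^sub>R G i v) sums vec_op z v"
proof -
  have "summable (\<lambda>i. (z \<bullet> b i) *\<^sub>R G i v)"
    unfolding summable_Cauchy
  proof (intro allI impI)
    fix e :: real assume e: "0 < e"
    have pos: "0 < e / (norm v + 1)" using e by (simp add: add_nonneg_pos)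
    have "summable (\<lambda>i. (z \<bullet> b i) *\<^sub>R b i)" using expansion_sums by (rule sums_summable)
    then have "Cauchy (\<lambda>n. \<Sum>i<n. (z \<bullet> b i) *\<^sub>R b i)"
      by (simp add: summable_iff_convergent convergent_Cauchy)
    then obtain N where N: "\<forall>m\<ge>N. \<forall>n\<ge>N. norm ((\<Sum>i<m. (z \<bullet> b i) *\<^sub>R b i) - (\<Sum>i<n. (z \<bullet> b i) *\<^sub>R b i)) < e / (norm v + 1)"
      using pos unfolding Cauchy_iff by blast
    have "norm (\<Sum>i=m..<n. (z \<bullet> b i) *\<^sub>R G i v) < e" if "m \<ge> N" for m n
    proof (cases "m \<le> n")
      case True
      have "(\<Sum>i=m..<n. (z \<bullet> b i) *\<^sub>R b i) = (\<Sum>i<n. (z \<bullet> b i) *\<^sub>R b i) - (\<Sum>i<m. (z \<bullet> b i) *\<^sub>R b i)"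
        using sum_diff_nat_ivl[of 0 m n "\<lambda>i. (z \<bullet> b i) *\<^sub>R b i"] True by (simp add: lessThan_atLeast0)
      then have "norm (\<Sum>i=m..<n. (z \<bullet> b i) *\<^sub>R b i) < e / (norm v + 1)" using N that True by simp
      then have "norm (\<Sum>i=m..<n. (z \<bullet> b i) *\<^sub>R b i) * (norm v + 1) < e"
        by (simp add: pos_less_divide_eq add_nonneg_pos)
      moreover have "norm (\<Sum>i=m..<n. (z \<bullet> b i) *\<^sub>R b i) * norm v \<le>
          norm (\<Sum>i=m..<n. (z \<bullet> b i) *\<^sub>R b i) * (norm v + 1)"
        by (intro mult_left_mono) auto
      ultimately show ?thesis by (simp add: norm_sum_G)
    qed (use e in simp)
    then show "\<exists>N. \<forall>m\<ge>N. \<forall>n. norm (\<Sum>i=m..<n. (z \<bullet> b i) *\<^sub>R G i v) < e" by blast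
  qed
  then show ?thesis unfolding vec_op_def by (rule summable_sums)
qed

lemma vec_op_basis: "vec_op (b n) v = G n v"
proof -
  have "(\<lambda>i. (b n \<bullet> b i) *\<^sub>R G i v) = (\<lambda>i. if i = n then G n v else 0)"
    by (auto simp: orthonormal)
  then show ?thesis using sums_unique2[OF vec_op_sums[of "b n" v]] sums_single[of n "\<lambda>_. G n v"]
    by (metis (mono_tags, lifting))
qed

lemma linear_vec_op_left: "linear (\<lambda>z. vec_op z v)"
proof (rule linearI)
  fix x y show "vec_op (x + y) v = vec_op x v + vec_op y v"
    using sums_unique2[OF vec_op_sums[of "x + y" v]] sums_add[OF vec_op_sums[of x v] vec_op_sums[of y v]]
    by (simp add: inner_add_left scaleR_add_left)
next
  fix r x show "vec_op (r *\<^sub>R x) v = r *\<^sub>R vec_op x v"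
    using sums_unique2[OF vec_op_sums[of "r *\<^sub>R x" v]] sums_scaleR_right[OF vec_op_sums[of x v], of r]
    by simp
qed

lemma linear_vec_op: "linear (vec_op z)"
proof (rule linearI)
  fix x y show "vec_op z (x + y) = vec_op z x + vec_op z y"
    using sums_unique2[OF vec_op_sums[of z "x + y"]] sums_add[OF vec_op_sums[of z x] vec_op_sums[of z y]]
    by (simp add: linear_add[OF linear_G] scaleR_add_right)
next
  fix r x show "vec_op z (r *\<^sub>R x) = r *\<^sub>R vec_op z x"
    using sums_unique2[OF vec_op_sums[of z "r *\<^sub>R x"]] sums_scaleR_right[OF vec_op_sums[of z x], of r]
    by (simp add: linear_scale[OF linear_G] mult.commute)
qed

lemma vec_op_skew: "vec_op z u \<bullet> v = - (u \<bullet> vec_op z v)"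
proof -
  have "(\<lambda>i. ((z \<bullet> b i) *\<^sub>R G i u) \<bullet> v) sums (vec_op z u \<bullet> v)"
    by (intro bounded_linear.sums[OF bounded_linear_inner_left] vec_op_sums)
  moreover have "(\<lambda>i. - (u \<bullet> ((z \<bullet> b i) *\<^sub>R G i v))) sums (- (u \<bullet> vec_op z v))"
    by (intro sums_minus bounded_linear.sums[OF bounded_linear_inner_right] vec_op_sums)
  ultimately show ?thesis by (simp add: skew_G sums_unique2)
qed

lemma norm_vec_op: "norm (vec_op z v) = norm z * norm v"
proof (rule LIMSEQ_unique)
  show "(\<lambda>n. norm (\<Sum>i<n. (z \<bullet> b i) *\<^sub>R G i v)) \<longlonglongrightarrow> norm (vec_op z v)"
    using vec_op_sums unfolding sums_def by (rule tendsto_norm)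
  show "(\<lambda>n. norm (\<Sum>i<n. (z \<bullet> b i) *\<^sub>R G i v)) \<longlonglongrightarrow> norm z * norm v"
    using expansion_sums unfolding sums_def
    by (simp add: norm_sum_G tendsto_mult_right tendsto_norm)
qed

lemma vec_op_square: "vec_op z (vec_op z v) = - ((z \<bullet> z) *\<^sub>R v)"
proof -
  \<comment> \<open>The operator multiplies all lengths by \<open>\<bar>z\<bar>\<close>, hence all inner products by \<open>\<bar>z\<bar>\<^sup>2\<close>.\<close>
  have polar: "vec_op z u \<bullet> vec_op z w = (z \<bullet> z) * (u \<bullet> w)" for u w
  proof -
    have n: "vec_op z x \<bullet> vec_op z x = (z \<bullet> z) * (x \<bullet> x)" for x
      using norm_vec_op[of z x] by (metis power2_norm_eq_inner power_mult_distrib)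
    show ?thesis using n[of "u + w"] n[of u] n[of w]
      by (simp add: linear_add[OF linear_vec_op] inner_add_left inner_add_right inner_commute
          algebra_simps)
  qed
  have "(vec_op z (vec_op z v) + (z \<bullet> z) *\<^sub>R v) \<bullet> w = 0" for w
    using vec_op_skew[of z "vec_op z v" w] polar[of v w] by (simp add: inner_add_left)
  then have "vec_op z (vec_op z v) + (z \<bullet> z) *\<^sub>R v = 0" by (metis inner_eq_zero_iff)
  then show ?thesis by (simp add: eq_neg_iff_add_eq_0)
qed

lemma vec_op_clifford: "vec_op z (vec_op w v) + vec_op w (vec_op z v) = - ((2 * (z \<bullet> w)) *\<^sub>R v)"
proof -
  have cancel: "M = - B" if "- A + M + - C = - (A + B + C)" for A B C M :: 'h
  proof -
    have "M = (- A + M + - C) + (A + C)" by simp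
    also have "\<dots> = - B" unfolding that by simp
    finally show ?thesis .
  qed
  have "- ((z \<bullet> z) *\<^sub>R v) + (vec_op z (vec_op w v) + vec_op w (vec_op z v)) + - ((w \<bullet> w) *\<^sub>R v) =
      vec_op (z + w) (vec_op (z + w) v)"
    unfolding vec_op_square[of z v, symmetric] vec_op_square[of w v, symmetric]
      linear_add[OF linear_vec_op_left] linear_add[OF linear_vec_op] by (simp only: ac_simps)
  also have "\<dots> = - (((z + w) \<bullet> (z + w)) *\<^sub>R v)" by (rule vec_op_square)
  also have "(z + w) \<bullet> (z + w) = z \<bullet> z + 2 * (z \<bullet> w) + w \<bullet> w"
    by (simp add: inner_add_left inner_add_right inner_commute[of w z])
  finally show ?thesis unfolding scaleR_add_left by (rule cancel)
qed

lemma vec_op_commute: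
  assumes "bounded_linear A" "\<And>n v. G n (A v) = A (G n v)"
  shows "vec_op z (A v) = A (vec_op z v)"
proof -
  interpret A: bounded_linear A by fact
  have "(\<lambda>i. A ((z \<bullet> b i) *\<^sub>R G i v)) sums A (vec_op z v)" by (intro A.sums vec_op_sums)
  then show ?thesis using sums_unique2[OF vec_op_sums[of z "A v"]] by (simp add: A.scaleR assms(2))
qed

end

section \<open>The universal property of the Clifford algebra\<close>

lemma clifford_vec_add: "clifford_vec (z + w) = clifford_vec z + clifford_vec w"
proof -
  have "tensor_vec (z + w) = tensor_vec z + tensor_vec w"
    by transfer (auto intro!: ideal_generated.gen simp: linear_relations_def)
  then show ?thesis by transfer (simp add: ideal_generated.zero)
qed

lemma clifford_vec_scaleR: "clifford_vec (r *\<^sub>R z) = r *\<^sub>R clifford_vec z"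
proof -
  have "tensor_vec (r *\<^sub>R z) = r *\<^sub>R tensor_vec z"
    by transfer (auto intro!: ideal_generated.gen simp: linear_relations_def)
  then show ?thesis by transfer (simp add: ideal_generated.zero)
qed

lemma poly_mapping_induct_single:
  assumes "P 0" "\<And>p q. P p \<Longrightarrow> P q \<Longrightarrow> P (p + q)" "\<And>k r. P (Poly_Mapping.single k r)"
  shows "P (p :: 'a \<Rightarrow>\<^sub>0 'b::comm_monoid_add)"
proof (induction p rule: update_induct)
  case (update f a b)
  have "Poly_Mapping.update a b f = f + Poly_Mapping.single a b"
    using update(1) by (intro poly_mapping_eqI)
      (auto simp: lookup_update lookup_add lookup_single when_def in_keys_iff)
  then show ?case using update assms by simp
qed fact

lemma word_poly_induct [case_names letter one add mult scale]:
  fixes p :: "'a word \<Rightarrow>\<^sub>0 real"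
  assumes letter: "\<And>z. P (letter z)" and one: "P 1"
    and add: "\<And>p q. P p \<Longrightarrow> P q \<Longrightarrow> P (p + q)"
    and mult: "\<And>p q. P p \<Longrightarrow> P q \<Longrightarrow> P (p * q)"
    and scale: "\<And>r p. P p \<Longrightarrow> P (const_poly r * p)"
  shows "P p"
proof (induction p rule: poly_mapping_induct_single)
  case 1
  show ?case using scale[OF one, of 0] by simp
next
  case (3 w r)
  have "P (Poly_Mapping.single (Word zs) 1)" for zs
  proof (induction zs)
    case Nil
    then show ?case using one by (simp add: zero_word_def[symmetric])
  next
    case (Cons z zs)
    then show ?case using mult[OF letter[of z] Cons] by (simp add: mult_single plus_word_def)
  qed
  then have "P (Poly_Mapping.single w 1)" by (metis word.collapse)
  from scale[OF this, of r] show ?case by (simp add: mult_single)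
qed (rule add)

lemma clifford_induct [case_names vec one add mult scaleR]:
  fixes a :: "'z::real_inner clifford"
  assumes vec: "\<And>z. P (clifford_vec z)" and one: "P 1"
    and add: "\<And>a b. P a \<Longrightarrow> P b \<Longrightarrow> P (a + b)"
    and mult: "\<And>a b. P a \<Longrightarrow> P b \<Longrightarrow> P (a * b)"
    and scaleR: "\<And>r a. P a \<Longrightarrow> P (r *\<^sub>R a)"
  shows "P a"
proof -
  have "P (abs_clifford (abs_tensor_algebra p))" for p :: "'z word \<Rightarrow>\<^sub>0 real"
  proof (induction p rule: word_poly_induct)
    case (letter z)
    show ?case using vec[of z] by (simp add: clifford_vec_def tensor_vec_def)
  next
    case one
    show ?case using assms(2) by (simp add: one_clifford_def one_tensor_algebra_def)
  next
    case (add p q)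
    then show ?case using assms(3) by (metis plus_clifford.abs_eq plus_tensor_algebra.abs_eq)
  next
    case (mult p q)
    then show ?case using assms(4) by (metis times_clifford.abs_eq times_tensor_algebra.abs_eq)
  next
    case (scale r p)
    then show ?case using assms(5) by (metis scaleR_clifford.abs_eq scaleR_tensor_algebra.abs_eq)
  qed
  moreover obtain t where "a = abs_clifford t" by (metis Quotient3_abs_rep[OF Quotient3_clifford])
  moreover obtain p where "t = abs_tensor_algebra p" by (metis Quotient3_abs_rep[OF Quotient3_tensor_algebra])
  ultimately show ?thesis by simp
qed

text \<open>
  The action of the free algebra on \<open>'z\<close> in which the letter \<open>z\<close> acts by \<open>J z\<close>; words act by
  composition.
\<close>

definition free_action :: "('z \<Rightarrow> 'h \<Rightarrow> 'h) \<Rightarrow> ('z word \<Rightarrow>\<^sub>0 real) \<Rightarrow> 'h \<Rightarrow> 'h::real_vector" where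
  "free_action J p v = (\<Sum>w\<in>Poly_Mapping.keys p. Poly_Mapping.lookup p w *\<^sub>R foldr J (letters w) v)"

lemma free_action_superset:
  assumes "finite S" "Poly_Mapping.keys p \<subseteq> S"
  shows "free_action J p v = (\<Sum>w\<in>S. Poly_Mapping.lookup p w *\<^sub>R foldr J (letters w) v)"
  unfolding free_action_def using assms
  by (intro sum.mono_neutral_left) (auto simp: in_keys_iff)

lemma free_action_add: "free_action J (p + q) v = free_action J p v + free_action J q v"
proof -
  let ?S = "Poly_Mapping.keys p \<union> Poly_Mapping.keys q"
  have fin: "finite ?S" by simp
  show ?thesis
    using free_action_superset[OF fin, of p J v] free_action_superset[OF fin, of q J v]
      free_action_superset[OF fin keys_add, of J v]
    by (simp add: lookup_add scaleR_add_left sum.distrib)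
qed

lemma free_action_single: "free_action J (Poly_Mapping.single w r) v = r *\<^sub>R foldr J (letters w) v"
  by (subst free_action_superset[of "{w}"]) auto

lemma free_action_0: "free_action J 0 v = 0"
  by (simp add: free_action_def)

lemma free_action_diff: "free_action J (p - q) v = free_action J p v - free_action J q v"
  using free_action_add[of J "p - q" q v] by simp

text \<open>A linear action of \<open>Z\<close> by linear operators subject to the Clifford relation.\<close>

locale clifford_action =
  fixes J :: "'z::real_inner \<Rightarrow> 'h::real_vector \<Rightarrow> 'h"
  assumes linear_J: "linear (J z)"
    and linear_J_left: "linear (\<lambda>z. J z v)"
    and clifford_J: "J z (J w v) + J w (J z v) = - ((2 * (z \<bullet> w)) *\<^sub>R v)"
begin

lemma linear_foldr: "linear (foldr J zs)"
proof (induction zs)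
  case (Cons z zs)
  then show ?case using linear_compose[OF Cons linear_J] by (simp add: o_def)
qed (simp add: id_def linear_ident)

lemma linear_free_action: "linear (free_action J p)"
  unfolding free_action_def
  by (intro linear_compose_sum ballI linear_compose_scale_right linear_foldr)

lemma free_action_mult: "free_action J (p * q) v = free_action J p (free_action J q v)"
proof (induction p rule: poly_mapping_induct_single)
  case (3 k r)
  show ?case
  proof (induction q rule: poly_mapping_induct_single)
    case (3 l s)
    show ?case
      by (simp add: mult_single free_action_single plus_word_def linear_scale[OF linear_foldr])
  qed (simp_all add: free_action_0 free_action_add distrib_left linear_0[OF linear_free_action]
      linear_add[OF linear_free_action])
qed (simp_all add: free_action_0 free_action_add distrib_right)

lemma free_action_letter: "free_action J (letter z) v = J z v"
  by (simp add: free_action_single)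

lemma free_action_const: "free_action J (const_poly r) v = r *\<^sub>R v"
  by (simp add: free_action_single zero_word_def)

lemma free_action_one: "free_action J 1 v = v"
  using free_action_const[of 1 v] by (metis scaleR_one single_one)

lemma free_action_ideal:
  assumes "p \<in> ideal_generated linear_relations"
  shows "free_action J p v = 0"
  using assms
proof (induction arbitrary: v)
  case (gen s)
  then show ?case
    by (auto simp: linear_relations_def free_action_diff free_action_add free_action_letter
        free_action_mult free_action_const linear_add[OF linear_J_left] linear_scale[OF linear_J_left])
qed (simp_all add: free_action_0 free_action_diff free_action_mult linear_0[OF linear_free_action])

text \<open>
  The induced actions of the tensor algebra and of the Clifford algebra are defined through arbitrary
  representatives; they do not depend on the choice, because the defining ideals act by zero.
\<close>

definition tensor_action :: "'z tensor_algebra \<Rightarrow> 'h \<Rightarrow> 'h" where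
  "tensor_action t = free_action J (rep_tensor_algebra t)"

lemma tensor_action_abs: "tensor_action (abs_tensor_algebra p) v = free_action J p v"
proof -
  have "abs_tensor_algebra (rep_tensor_algebra (abs_tensor_algebra p)) = abs_tensor_algebra p"
    by (rule Quotient3_abs_rep[OF Quotient3_tensor_algebra])
  then have "rep_tensor_algebra (abs_tensor_algebra p) - p \<in> ideal_generated linear_relations"
    by (simp add: tensor_algebra.abs_eq_iff)
  from free_action_ideal[OF this, of v] show ?thesis
    by (simp add: free_action_diff tensor_action_def)
qed

lemma
  shows tensor_action_add: "tensor_action (s + t) v = tensor_action s v + tensor_action t v"
    and tensor_action_diff: "tensor_action (s - t) v = tensor_action s v - tensor_action t v"
    and tensor_action_mult: "tensor_action (s * t) v = tensor_action s (tensor_action t v)"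
    and tensor_action_scaleR: "tensor_action (r *\<^sub>R t) v = r *\<^sub>R tensor_action t v"
proof -
  obtain p where s: "s = abs_tensor_algebra p" by (metis Quotient3_abs_rep[OF Quotient3_tensor_algebra])
  obtain q where t: "t = abs_tensor_algebra q" by (metis Quotient3_abs_rep[OF Quotient3_tensor_algebra])
  show "tensor_action (s + t) v = tensor_action s v + tensor_action t v"
    by (simp add: s t plus_tensor_algebra.abs_eq tensor_action_abs free_action_add)
  show "tensor_action (s - t) v = tensor_action s v - tensor_action t v"
    by (simp add: s t minus_tensor_algebra.abs_eq tensor_action_abs free_action_diff)
  show "tensor_action (s * t) v = tensor_action s (tensor_action t v)"
    by (simp add: s t times_tensor_algebra.abs_eq tensor_action_abs free_action_mult)
  show "tensor_action (r *\<^sub>R t) v = r *\<^sub>R tensor_action t v"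
    by (simp add: t scaleR_tensor_algebra.abs_eq tensor_action_abs free_action_mult free_action_const)
qed

lemma tensor_action_0: "tensor_action 0 v = 0"
  using tensor_action_diff[of 0 0 v] by simp

lemma tensor_action_one: "tensor_action 1 v = v"
  by (simp add: one_tensor_algebra_def tensor_action_abs free_action_one)

lemma tensor_action_vec: "tensor_action (tensor_vec z) v = J z v"
  by (simp add: tensor_vec_def tensor_action_abs free_action_letter)

lemma linear_tensor_action: "linear (tensor_action t)"
  unfolding tensor_action_def by (rule linear_free_action)

lemma tensor_action_ideal:
  assumes "t \<in> ideal_generated clifford_relations"
  shows "tensor_action t v = 0"
  using assms
proof (induction arbitrary: v)
  case (gen s)
  then show ?case
    by (auto simp: clifford_relations_def tensor_action_add tensor_action_mult tensor_action_vec
        tensor_action_scaleR tensor_action_one clifford_J)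
qed (simp_all add: tensor_action_0 tensor_action_diff tensor_action_mult
    linear_0[OF linear_tensor_action])

text \<open>The operator by which an element of the Clifford algebra acts.\<close>

definition clifford_op :: "'z clifford \<Rightarrow> 'h \<Rightarrow> 'h" where
  "clifford_op a = tensor_action (rep_clifford a)"

lemma clifford_op_abs: "clifford_op (abs_clifford t) v = tensor_action t v"
proof -
  have "abs_clifford (rep_clifford (abs_clifford t)) = abs_clifford t"
    by (rule Quotient3_abs_rep[OF Quotient3_clifford])
  then have "rep_clifford (abs_clifford t) - t \<in> ideal_generated clifford_relations"
    by (simp add: clifford.abs_eq_iff)
  from tensor_action_ideal[OF this, of v] show ?thesis
    by (simp add: tensor_action_diff clifford_op_def)
qed

lemma
  shows clifford_op_add: "clifford_op (a + b) v = clifford_op a v + clifford_op b v"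
    and clifford_op_diff: "clifford_op (a - b) v = clifford_op a v - clifford_op b v"
    and clifford_op_mult: "clifford_op (a * b) v = clifford_op a (clifford_op b v)"
    and clifford_op_scaleR: "clifford_op (r *\<^sub>R a) v = r *\<^sub>R clifford_op a v"
proof -
  obtain s where s: "a = abs_clifford s" by (metis Quotient3_abs_rep[OF Quotient3_clifford])
  obtain t where t: "b = abs_clifford t" by (metis Quotient3_abs_rep[OF Quotient3_clifford])
  show "clifford_op (a + b) v = clifford_op a v + clifford_op b v"
    by (simp add: s t plus_clifford.abs_eq clifford_op_abs tensor_action_add)
  show "clifford_op (a - b) v = clifford_op a v - clifford_op b v"
    by (simp add: s t minus_clifford.abs_eq clifford_op_abs tensor_action_diff)
  show "clifford_op (a * b) v = clifford_op a (clifford_op b v)"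
    by (simp add: s t times_clifford.abs_eq clifford_op_abs tensor_action_mult)
  show "clifford_op (r *\<^sub>R a) v = r *\<^sub>R clifford_op a v"
    by (simp add: s scaleR_clifford.abs_eq clifford_op_abs tensor_action_scaleR)
qed

lemma clifford_op_0: "clifford_op 0 v = 0"
  using clifford_op_diff[of 0 0 v] by simp

lemma clifford_op_one: "clifford_op 1 v = v"
  by (simp add: one_clifford_def clifford_op_abs tensor_action_one)

lemma clifford_op_vec: "clifford_op (clifford_vec z) v = J z v"
  by (simp add: clifford_vec_def clifford_op_abs tensor_action_vec)

lemma linear_clifford_op: "linear (clifford_op a)"
  unfolding clifford_op_def by (rule linear_tensor_action)

lemma clifford_op_commute:
  assumes "linear A" "\<And>z v. J z (A v) = A (J z v)"
  shows "clifford_op a (A v) = A (clifford_op a v)"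
  by (induction a arbitrary: v rule: clifford_induct)
    (simp_all add: clifford_op_vec clifford_op_one clifford_op_add clifford_op_mult
      clifford_op_scaleR assms linear_add linear_scale)

end

section \<open>Haar measure and square-integrable functions\<close>

lemma sets_haar_X [measurable_cong]: "sets haar_X = sets borel"
  using is_haar_measure_haar_X by (simp add: is_haar_measure_def)

lemma space_haar_X [simp]: "space haar_X = UNIV"
  using sets_eq_imp_space_eq[OF sets_haar_X] by simp

interpretation haar: prob_space haar_X
  using is_haar_measure_haar_X by (simp add: is_haar_measure_def)

lemma distr_haar_translate: "distr haar_X haar_X (\<lambda>x. x \<oplus>\<^sub>X y) = haar_X"
proof -
  have "(\<lambda>x. x \<oplus>\<^sub>X y) = (\<lambda>x. y \<oplus>\<^sub>X x)" by (simp add: xadd_commute)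
  then show ?thesis using is_haar_measure_haar_X by (simp add: is_haar_measure_def)
qed

lemma measurable_translate [measurable]: "(\<lambda>x. x \<oplus>\<^sub>X y) \<in> haar_X \<rightarrow>\<^sub>M haar_X"
  using measurable_xadd[of "\<lambda>x. x" haar_X "\<lambda>_. y"]
  by (simp add: measurable_cong_sets[OF refl sets_haar_X] measurable_cong_sets[OF sets_haar_X refl])

lemma AE_haar_translate:
  assumes "AE x in haar_X. P x"
  shows "AE x in haar_X. P (x \<oplus>\<^sub>X y)"
proof (rule AE_distrD[OF measurable_translate[of y]])
  show "almost_everywhere (distr haar_X haar_X (\<lambda>x. x \<oplus>\<^sub>X y)) P"
    by (subst distr_haar_translate) (rule assms)
qed

lemma integral_haar_translate:
  fixes f :: "cantor \<Rightarrow> 'b::{banach, second_countable_topology}"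
  assumes "f \<in> borel_measurable haar_X"
  shows "(\<integral>x. f (x \<oplus>\<^sub>X y) \<partial>haar_X) = (\<integral>x. f x \<partial>haar_X)"
  using integral_distr[OF measurable_translate assms, of y] by (simp add: distr_haar_translate)

lemma integrable_haar_translate:
  fixes f :: "cantor \<Rightarrow> 'b::{banach, second_countable_topology}"
  assumes "integrable haar_X f"
  shows "integrable haar_X (\<lambda>x. f (x \<oplus>\<^sub>X y))"
  by (rule integrable_distr[OF measurable_translate[of y]]) (simp add: distr_haar_translate assms)

lemma square_integrable_measurable: "square_integrable f \<Longrightarrow> f \<in> borel_measurable haar_X"
  by (simp add: square_integrable_def)

lemma square_integrable_translate:
  "square_integrable f \<Longrightarrow> square_integrable (\<lambda>x. f (x \<oplus>\<^sub>X y))"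
  unfolding square_integrable_def
  using integrable_haar_translate[of "\<lambda>x. (cmod (f x))\<^sup>2"] measurable_compose[OF measurable_translate]
  by blast

lemma square_integrable_bounded_mult:
  assumes "square_integrable f" "g \<in> borel_measurable haar_X" "\<And>x. cmod (g x) \<le> 1"
  shows "square_integrable (\<lambda>x. g x * f x)"
proof -
  have [measurable]: "f \<in> borel_measurable haar_X" "g \<in> borel_measurable haar_X"
    and int: "integrable haar_X (\<lambda>x. (cmod (f x))\<^sup>2)"
    using assms by (auto simp: square_integrable_def)
  have "integrable haar_X (\<lambda>x. (cmod (g x * f x))\<^sup>2)"
  proof (rule Bochner_Integration.integrable_bound[OF int])
    have "(cmod (g x) * cmod (f x))\<^sup>2 \<le> (cmod (f x))\<^sup>2" for x
      by (rule power_mono) (auto intro!: mult_left_le_one_le assms(3))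
    then show "AE x in haar_X. norm ((cmod (g x * f x))\<^sup>2) \<le> norm ((cmod (f x))\<^sup>2)"
      by (simp add: norm_mult)
  qed measurable
  then show ?thesis by (simp add: square_integrable_def)
qed

lemma square_integrable_const: "square_integrable (\<lambda>_. c)"
  by (simp add: square_integrable_def)

lemma square_integrable_bounded:
  "g \<in> borel_measurable haar_X \<Longrightarrow> (\<And>x. cmod (g x) \<le> 1) \<Longrightarrow> square_integrable g"
  using square_integrable_bounded_mult[OF square_integrable_const[of 1]] by simp

lemma square_integrable_integrable:
  assumes "square_integrable f"
  shows "integrable haar_X f"
  using square_integrable_mult[OF assms square_integrable_const[of 1]] by simp

lemma square_integrable_diff:
  "square_integrable f \<Longrightarrow> square_integrable g \<Longrightarrow> square_integrable (\<lambda>x. f x - g x)"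
  using square_integrable_add[of f "\<lambda>x. -1 * g x"] square_integrable_cmult[of g "-1"] by simp

section \<open>Classes and their representatives\<close>

lemma square_integrable_fun_of: "square_integrable (fun_of F)"
  using Quotient3_rep_reflp[OF Quotient3_L2X, of F] by (simp add: fun_of_def)

lemma abs_fun_of [simp]: "abs_L2X (fun_of F) = F"
  unfolding fun_of_def by (rule Quotient3_abs_rep[OF Quotient3_L2X])

lemma AE_fun_of_abs:
  assumes "square_integrable f"
  shows "AE x in haar_X. fun_of (abs_L2X f) x = f x"
  using rep_abs_rsp_left[OF Quotient3_L2X, of f f] assms by (simp add: fun_of_def)

lemma abs_L2X_eqI:
  assumes "square_integrable f" "square_integrable g" "AE x in haar_X. f x = g x"
  shows "abs_L2X f = abs_L2X g"
  using Quotient3_rel_abs[OF Quotient3_L2X, of f g] assms by simp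

lemma L2X_eqI:
  assumes "AE x in haar_X. fun_of F x = fun_of G x"
  shows "F = G"
  using abs_L2X_eqI[OF square_integrable_fun_of square_integrable_fun_of assms] by simp

lemma L2X_cases: obtains f where "square_integrable f" "F = abs_L2X f"
  by (metis abs_fun_of square_integrable_fun_of)

lemma abs_L2X_plus:
  "square_integrable f \<Longrightarrow> square_integrable g \<Longrightarrow> abs_L2X f + abs_L2X g = abs_L2X (\<lambda>x. f x + g x)"
  by (rule plus_L2X.abs_eq) simp_all

lemma abs_L2X_scaleC: "square_integrable f \<Longrightarrow> scaleC_L2X c (abs_L2X f) = abs_L2X (\<lambda>x. c * f x)"
  by (rule scaleC_L2X.abs_eq) simp_all

lemma abs_L2X_uminus: "square_integrable f \<Longrightarrow> - abs_L2X f = abs_L2X (\<lambda>x. - f x)"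
  by (simp add: uminus_L2X_def abs_L2X_scaleC)

lemma abs_L2X_diff:
  "square_integrable f \<Longrightarrow> square_integrable g \<Longrightarrow> abs_L2X f - abs_L2X g = abs_L2X (\<lambda>x. f x - g x)"
  using square_integrable_cmult[of g "-1"]
  by (simp add: minus_L2X_def abs_L2X_uminus abs_L2X_plus)

lemma abs_L2X_herm:
  "square_integrable f \<Longrightarrow> square_integrable g \<Longrightarrow>
    herm_L2X (abs_L2X f) (abs_L2X g) = (\<integral>x. f x * cnj (g x) \<partial>haar_X)"
  by (rule herm_L2X.abs_eq) simp_all

lemma norm_abs_L2X:
  assumes "square_integrable f"
  shows "(norm (abs_L2X f))\<^sup>2 = (\<integral>x. (cmod (f x))\<^sup>2 \<partial>haar_X)"
proof -
  have "(norm (abs_L2X f))\<^sup>2 = Re (\<integral>x. f x * cnj (f x) \<partial>haar_X)"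
    using assms by (simp add: power2_norm_eq_inner inner_L2X_def abs_L2X_herm)
  also have "\<dots> = (\<integral>x. (cmod (f x))\<^sup>2 \<partial>haar_X)"
    by (simp add: complex_norm_square[symmetric] flip: of_real_power)
  finally show ?thesis .
qed

lemma abs_L2X_eq_0_iff:
  assumes "square_integrable f"
  shows "abs_L2X f = 0 \<longleftrightarrow> (AE x in haar_X. f x = 0)"
  using Quotient3_rel[OF Quotient3_L2X, of f "\<lambda>_. 0"] assms
  by (simp add: zero_L2X_def square_integrable_const)

section \<open>The hermitian inner product of $L_2(X)$\<close>

lemma herm_L2X_add_left: "herm_L2X (F + G) H = herm_L2X F H + herm_L2X G H"
  by transfer (simp add: distrib_right square_integrable_mult)

lemma herm_L2X_scaleC_left: "herm_L2X (scaleC_L2X c F) G = c * herm_L2X F G"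
  by transfer (simp add: mult.assoc)

lemma herm_L2X_commute: "herm_L2X G F = cnj (herm_L2X F G)"
proof transfer
  fix f g
  assume "square_integrable g \<and> square_integrable g \<and> (AE x in haar_X. g x = g x)"
    "square_integrable f \<and> square_integrable f \<and> (AE x in haar_X. f x = f x)"
  then have int: "integrable haar_X (\<lambda>x. f x * cnj (g x))"
    by (simp add: square_integrable_mult)
  have "(\<integral>x. g x * cnj (f x) \<partial>haar_X) = (\<integral>x. cnj (f x * cnj (g x)) \<partial>haar_X)"
    by (simp add: mult.commute)
  also have "\<dots> = cnj (\<integral>x. f x * cnj (g x) \<partial>haar_X)"
    by (rule integral_bounded_linear[OF bounded_linear_cnj int])
  finally show "(\<integral>x. g x * cnj (f x) \<partial>haar_X) = cnj (\<integral>x. f x * cnj (g x) \<partial>haar_X)" .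
qed

lemma herm_L2X_add_right: "herm_L2X F (G + H) = herm_L2X F G + herm_L2X F H"
  by (metis complex_cnj_add herm_L2X_add_left herm_L2X_commute)

lemma herm_L2X_scaleC_right: "herm_L2X F (scaleC_L2X c G) = cnj c * herm_L2X F G"
  by (metis complex_cnj_mult herm_L2X_commute herm_L2X_scaleC_left)

lemma Re_herm_L2X: "Re (herm_L2X F G) = F \<bullet> G"
  by (simp add: inner_L2X_def)

lemma Im_herm_L2X: "Im (herm_L2X F G) = F \<bullet> scaleC_L2X \<i> G"
  by (simp add: inner_L2X_def herm_L2X_scaleC_right)

lemma scaleC_L2X_add_right: "scaleC_L2X c (F + G) = scaleC_L2X c F + scaleC_L2X c G"
  by transfer (auto simp only: square_integrable_add square_integrable_cmult distrib_left)

lemma scaleC_L2X_add_left: "scaleC_L2X (c + d) F = scaleC_L2X c F + scaleC_L2X d F"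
  by transfer (auto simp only: square_integrable_add square_integrable_cmult distrib_right)

lemma scaleC_L2X_scaleC: "scaleC_L2X c (scaleC_L2X d F) = scaleC_L2X (c * d) F"
  by transfer (auto simp: square_integrable_cmult mult.assoc)

lemma scaleC_L2X_of_real: "scaleC_L2X (of_real r) F = r *\<^sub>R F"
  by (simp add: scaleR_L2X_def)

lemma scaleC_L2X_scaleR: "scaleC_L2X c (r *\<^sub>R F) = r *\<^sub>R scaleC_L2X c F"
  by (simp add: scaleR_L2X_def scaleC_L2X_scaleC mult.commute)

lemma norm_scaleC_L2X: "norm (scaleC_L2X c F) = cmod c * norm F"
proof -
  have "(norm (scaleC_L2X c F))\<^sup>2 = Re (c * cnj c * herm_L2X F F)"
    by (simp add: power2_norm_eq_inner inner_L2X_def herm_L2X_scaleC_left herm_L2X_scaleC_right ac_simps)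
  also have "\<dots> = (cmod c * norm F)\<^sup>2"
    by (simp add: complex_norm_square[symmetric] power_mult_distrib power2_norm_eq_inner inner_L2X_def
      flip: of_real_power)
  finally show ?thesis by simp
qed

lemma bounded_linear_scaleC_L2X: "bounded_linear (scaleC_L2X c)"
  by (rule bounded_linear_intro[where K = "cmod c"])
    (simp_all add: scaleC_L2X_add_right scaleC_L2X_scaleR norm_scaleC_L2X)

section \<open>Completeness of $L_2(X)$\<close>

text \<open>
  A Cauchy sequence in \<open>L\<^sub>2(X)\<close> is Cauchy in the \<open>L\<^sub>1\<close> norm, so a subsequence converges almost everywhere;
  by Fatou's lemma the pointwise limit is also the limit in \<open>L\<^sub>2(X)\<close>.
\<close>

instance L2X :: banach
proof
  fix X :: "nat \<Rightarrow> L2X" assume X: "Cauchy X"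
  define s where "s n = fun_of (X n)" for n
  have sq: "square_integrable (s n)" for n unfolding s_def by (rule square_integrable_fun_of)
  have [measurable]: "s n \<in> borel_measurable haar_X" for n
    using sq by (rule square_integrable_measurable)
  have norm_X: "(norm (X m - X n))\<^sup>2 = (\<integral>x. (cmod (s m x - s n x))\<^sup>2 \<partial>haar_X)" for m n
    using norm_abs_L2X[OF square_integrable_diff[OF sq[of m] sq[of n]]]
    by (simp add: abs_L2X_diff[OF sq sq, symmetric]) (simp add: s_def)
  have L1: "(\<integral>x. cmod (s m x - s n x) \<partial>haar_X) \<le> norm (X m - X n)" for m n
  proof -
    have d: "square_integrable (\<lambda>x. s m x - s n x)" by (intro square_integrable_diff sq)
    have i1: "integrable haar_X (\<lambda>x. cmod (s m x - s n x))"
      using square_integrable_integrable[OF d] by (rule integrable_norm)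
    have i2: "integrable haar_X (\<lambda>x. (cmod (s m x - s n x))\<^sup>2)"
      using d by (simp add: square_integrable_def)
    \<comment> \<open>The mean is at most the quadratic mean, since the variance is nonnegative.\<close>
    have "0 \<le> haar.variance (\<lambda>x. cmod (s m x - s n x))" by (rule haar.variance_positive)
    then have "(\<integral>x. cmod (s m x - s n x) \<partial>haar_X)\<^sup>2 \<le> (norm (X m - X n))\<^sup>2"
      using haar.variance_eq[OF i1 i2] by (simp add: norm_X)
    then show ?thesis by (rule power2_le_imp_le) simp
  qed
  have "\<exists>N. \<forall>i\<ge>N. \<forall>j\<ge>N. (LINT x|haar_X. norm (s i x - s j x)) < e" if "e > 0" for e
    using X[unfolded Cauchy_iff, rule_format, OF that] L1 by (meson le_less_trans)
  then obtain r where r: "strict_mono r" "AE x in haar_X. Cauchy (\<lambda>i. s (r i) x)"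
    using cauchy_L1_AE_cauchy_subseq[of haar_X s] square_integrable_integrable[OF sq] by blast
  define f where "f x = lim (\<lambda>i. s (r i) x)" for x
  have [measurable]: "f \<in> borel_measurable haar_X" unfolding f_def by measurable
  have lim: "AE x in haar_X. (\<lambda>i. s (r i) x) \<longlonglongrightarrow> f x"
    using r(2) unfolding f_def by (auto simp: Cauchy_convergent_iff convergent_LIMSEQ_iff)
  have fatou: "(\<integral>\<^sup>+x. ennreal ((cmod (f x - s n x))\<^sup>2) \<partial>haar_X) \<le> ennreal (e\<^sup>2)"
    if e: "0 < e" and n: "\<And>m. m \<ge> n \<Longrightarrow> norm (X m - X n) < e" for e n
  proof -
    have "AE x in haar_X. ennreal ((cmod (f x - s n x))\<^sup>2) =
        liminf (\<lambda>i. ennreal ((cmod (s (r i) x - s n x))\<^sup>2))"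
      using lim
    proof eventually_elim
      case (elim x)
      then have "(\<lambda>i. ennreal ((cmod (s (r i) x - s n x))\<^sup>2)) \<longlonglongrightarrow> ennreal ((cmod (f x - s n x))\<^sup>2)"
        by (intro tendsto_intros)
      then show ?case by (rule lim_imp_Liminf[OF sequentially_bot, symmetric])
    qed
    then have "(\<integral>\<^sup>+x. ennreal ((cmod (f x - s n x))\<^sup>2) \<partial>haar_X) =
        (\<integral>\<^sup>+x. liminf (\<lambda>i. ennreal ((cmod (s (r i) x - s n x))\<^sup>2)) \<partial>haar_X)"
      by (rule nn_integral_cong_AE)
    also have "\<dots> \<le> liminf (\<lambda>i. \<integral>\<^sup>+x. ennreal ((cmod (s (r i) x - s n x))\<^sup>2) \<partial>haar_X)"
      by (rule nn_integral_liminf) simp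
    also have "\<dots> \<le> ennreal (e\<^sup>2)"
    proof (rule Liminf_le[OF sequentially_bot])
      have "(\<integral>\<^sup>+x. ennreal ((cmod (s (r i) x - s n x))\<^sup>2) \<partial>haar_X) \<le> ennreal (e\<^sup>2)" if "i \<ge> n" for i
      proof -
        have "r i \<ge> n" using seq_suble[OF r(1), of i] that by linarith
        have "(\<integral>\<^sup>+x. ennreal ((cmod (s (r i) x - s n x))\<^sup>2) \<partial>haar_X) =
            ennreal ((norm (X (r i) - X n))\<^sup>2)"
          unfolding norm_X using square_integrable_diff[OF sq[of "r i"] sq[of n]]
          by (intro nn_integral_eq_integral) (auto simp: square_integrable_def)
        also have "\<dots> \<le> ennreal (e\<^sup>2)"
          using n[OF \<open>r i \<ge> n\<close>] by (intro ennreal_leI power_mono) auto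
        finally show ?thesis .
      qed
      then show "\<forall>\<^sub>F i in sequentially.
          (\<integral>\<^sup>+x. ennreal ((cmod (s (r i) x - s n x))\<^sup>2) \<partial>haar_X) \<le> ennreal (e\<^sup>2)"
        by (auto simp: eventually_sequentially)
    qed
    finally show ?thesis .
  qed
  have near: "square_integrable (\<lambda>x. f x - s n x) \<and> (norm (abs_L2X (\<lambda>x. f x - s n x))) \<le> e"
    if e: "0 < e" and n: "\<And>m. m \<ge> n \<Longrightarrow> norm (X m - X n) < e" for e n
  proof -
    have fin: "(\<integral>\<^sup>+x. ennreal ((cmod (f x - s n x))\<^sup>2) \<partial>haar_X) \<le> ennreal (e\<^sup>2)"
      using fatou[OF e] n by blast
    then have int: "integrable haar_X (\<lambda>x. (cmod (f x - s n x))\<^sup>2)"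
      by (intro integrableI_bounded) (auto simp: order_le_less_trans)
    then have sqd: "square_integrable (\<lambda>x. f x - s n x)" by (simp add: square_integrable_def)
    have "ennreal ((norm (abs_L2X (\<lambda>x. f x - s n x)))\<^sup>2) \<le> ennreal (e\<^sup>2)"
      using fin nn_integral_eq_integral[OF int] by (simp add: norm_abs_L2X[OF sqd])
    then have "(norm (abs_L2X (\<lambda>x. f x - s n x)))\<^sup>2 \<le> e\<^sup>2" by (simp add: ennreal_le_iff)
    then have "norm (abs_L2X (\<lambda>x. f x - s n x)) \<le> e"
      by (rule power2_le_imp_le) (use e in simp)
    then show ?thesis using sqd by blast
  qed
  have tail: "\<exists>N. \<forall>n\<ge>N. \<forall>m\<ge>n. norm (X m - X n) < e" if "0 < e" for e
    using X[unfolded Cauchy_iff, rule_format, OF that] by (meson order_trans)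
  have sqf: "square_integrable f"
  proof -
    obtain n where "\<forall>m\<ge>n. norm (X m - X n) < 1" using tail[of 1] by auto
    then have "square_integrable (\<lambda>x. f x - s n x)" using near[of 1 n] by auto
    from square_integrable_add[OF this sq[of n]] show ?thesis by simp
  qed
  have "X \<longlonglongrightarrow> abs_L2X f"
  proof (rule LIMSEQ_I)
    fix e :: real assume e: "0 < e"
    obtain N where N: "\<forall>n\<ge>N. \<forall>m\<ge>n. norm (X m - X n) < e / 2" using tail[of "e / 2"] e by auto
    have "norm (X n - abs_L2X f) < e" if "n \<ge> N" for n
    proof -
      have "norm (abs_L2X (\<lambda>x. f x - s n x)) \<le> e / 2" using near[of "e / 2" n] N that e by auto
      then have "norm (abs_L2X f - X n) \<le> e / 2"
        by (simp add: abs_L2X_diff[OF sqf sq, symmetric]) (simp add: s_def)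
      then show ?thesis using e by (simp add: norm_minus_commute)
    qed
    then show "\<exists>N. \<forall>n\<ge>N. norm (X n - abs_L2X f) < e" by blast
  qed
  then show "convergent X" by (auto simp: convergent_def)
qed

section \<open>Walsh functions\<close>

text \<open>The character \<open>x \<mapsto> (-1)\<^bsup>x k\<^esup>\<close> of \<open>X\<close>, and the finite products of such characters.\<close>

definition rademacher :: "nat \<Rightarrow> cantor \<Rightarrow> complex" where
  "rademacher k x = (-1) ^ of_bool (x k)"

definition walsh :: "nat set \<Rightarrow> cantor \<Rightarrow> complex" where
  "walsh B x = (\<Prod>k\<in>B. rademacher k x)"

lemma rademacher_alt: "rademacher k x = (if x k then - 1 else 1)"
  by (simp add: rademacher_def)

lemma measurable_coordinate: "{x \<in> space haar_X. x k} \<in> sets haar_X"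
proof -
  have "open ((\<lambda>x::cantor. x k) -` {True})"
    by (intro open_vimage open_discrete continuous_on_product_coordinates)
  then show ?thesis by (simp add: vimage_def sets_haar_X)
qed

lemma measurable_rademacher [measurable]: "rademacher k \<in> borel_measurable haar_X"
proof -
  have [measurable]: "Measurable.pred haar_X (\<lambda>x. x k)"
    using measurable_coordinate by (simp add: pred_def)
  show ?thesis unfolding rademacher_alt by measurable
qed

lemma measurable_walsh [measurable]: "walsh B \<in> borel_measurable haar_X"
  unfolding walsh_def by measurable

lemma cmod_rademacher [simp]: "cmod (rademacher k x) = 1"
  by (simp add: rademacher_alt)

lemma cmod_walsh [simp]: "cmod (walsh B x) = 1"
  by (simp add: walsh_def prod_norm[symmetric])

lemma cnj_rademacher [simp]: "cnj (rademacher k x) = rademacher k x"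
  by (simp add: rademacher_alt)

lemma rademacher_square: "rademacher k x * rademacher k x = 1"
  by (simp add: rademacher_alt)

lemma cnj_walsh [simp]: "cnj (walsh B x) = walsh B x"
  by (simp add: walsh_def)

lemma walsh_empty [simp]: "walsh {} x = 1"
  by (simp add: walsh_def)

lemma walsh_insert: "finite B \<Longrightarrow> k \<notin> B \<Longrightarrow> walsh (insert k B) x = rademacher k x * walsh B x"
  by (simp add: walsh_def)

lemma walsh_times_rademacher:
  assumes "finite B"
  shows "\<exists>B'. finite B' \<and> (\<forall>x. rademacher k x * walsh B x = walsh B' x)"
proof (cases "k \<in> B")
  case True
  then have "rademacher k x * walsh B x = walsh (B - {k}) x" for x
    using assms by (simp add: walsh_def prod.remove[of B k] mult.assoc[symmetric] rademacher_square)
  then show ?thesis using assms by blast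
next
  case False
  then show ?thesis using assms walsh_insert by (metis finite_insert)
qed

lemma walsh_square: "walsh B x * walsh B x = 1"
  by (simp add: walsh_def prod.distrib[symmetric] rademacher_square)

lemma rademacher_delta: "rademacher k (x \<oplus>\<^sub>X delta l) = (if k = l then - rademacher k x else rademacher k x)"
  by (simp add: rademacher_alt xadd_def delta_def)

lemma walsh_delta:
  "finite B \<Longrightarrow> walsh B (x \<oplus>\<^sub>X delta l) = (if l \<in> B then - walsh B x else walsh B x)"
  by (induction B rule: finite_induct) (auto simp: walsh_insert rademacher_delta)

lemma rademacher_xcompl: "rademacher k (xcompl x) = - rademacher k x"
  by (simp add: rademacher_alt xcompl_def)

lemma walsh_xcompl: "finite B \<Longrightarrow> walsh B (xcompl x) = (-1) ^ card B * walsh B x"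
  by (induction B rule: finite_induct) (auto simp: walsh_insert rademacher_xcompl)

text \<open>The generating sets are closed under intersection and have Walsh polynomials as indicators.\<close>

lemma sets_haar_X_generated:
  "sets haar_X = sigma_sets UNIV {{x. \<forall>j\<in>B. x j} | B. finite B}" (is "_ = sigma_sets UNIV ?G")
proof (rule equalityI)
  interpret S: sigma_algebra UNIV "sigma_sets UNIV ?G"
    by (rule sigma_algebra_sigma_sets) simp
  have single: "{x. x i} \<in> sigma_sets UNIV ?G" for i :: nat
    by (rule sigma_sets.Basic) (auto intro!: exI[of _ "{i}"])
  have "{x. x i \<in> A} \<in> sigma_sets UNIV ?G" for i :: nat and A :: "bool set"
  proof -
    have "{x. x i \<in> A} = (if True \<in> A then {x. x i} else {}) \<union>
        (if False \<in> A then UNIV - {x. x i} else {})"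
      (is "?L = ?R")
    proof (rule set_eqI)
      fix x :: cantor
      show "x \<in> ?L \<longleftrightarrow> x \<in> ?R" by (cases "x i") simp_all
    qed
    also have "\<dots> \<in> sigma_sets UNIV ?G"
      using single[of i] S.compl_sets[OF single[of i]] by (intro S.Un) (simp_all add: sigma_sets.Empty)
    finally show ?thesis .
  qed
  moreover have "sets haar_X = sigma_sets UNIV {{x::cantor. x i \<in> A} | i A. True}"
    unfolding sets_haar_X sets_PiM_equal_borel[symmetric]
    by (simp add: sets_PiM_single sets_borel_bool space_borel)
  ultimately show "sets haar_X \<subseteq> sigma_sets UNIV ?G"
    by (auto intro!: sigma_sets_mono)
  have "{x. \<forall>j\<in>F. x j} \<in> sets haar_X" if "finite F" for F
  proof -
    have "{x. \<forall>j\<in>F. x j} = {x \<in> space haar_X. \<forall>j\<in>F. x j}" by simp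
    also have "\<dots> \<in> sets haar_X"
      by (rule sets.sets_Collect_finite_All) (use measurable_coordinate that in auto)
    finally show ?thesis .
  qed
  then show "sigma_sets UNIV ?G \<subseteq> sets haar_X"
    using sets.sigma_sets_subset[of ?G haar_X] by auto
qed

text \<open>
  Completeness of the Walsh functions. Vanishing coefficients make the integral of \<open>h\<close> over each
  generating set zero, hence over all measurable sets by the \<open>\<pi>\<close>-\<open>\<lambda>\<close> theorem.
\<close>

lemma walsh_complete:
  assumes h: "integrable haar_X h"
    and coeff: "\<And>B. finite B \<Longrightarrow> (\<integral>x. walsh B x * h x \<partial>haar_X) = 0"
  shows "AE x in haar_X. h x = 0"
proof -
  have [measurable]: "h \<in> borel_measurable haar_X" using h by auto
  have int: "integrable haar_X (\<lambda>x. g x * h x)"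
    if "g \<in> borel_measurable haar_X" "\<And>x. cmod (g x) \<le> 1" for g :: "cantor \<Rightarrow> complex"
  proof (rule Bochner_Integration.integrable_bound[OF h])
    show "AE x in haar_X. norm (g x * h x) \<le> norm (h x)"
      using that(2) by (auto simp: norm_mult intro!: mult_left_le_one_le)
  qed (use that in measurable)
  \<comment> \<open>The indicator of the set where all entries with index in \<open>B\<close> are 1.\<close>
  define p where "p B x = (\<Prod>k\<in>B. (1 - rademacher k x) / 2)" for B x
  have p_meas [measurable]: "p B \<in> borel_measurable haar_X" for B unfolding p_def by measurable
  have p_ind: "p B x = indicator {x. \<forall>j\<in>B. x j} x" if "finite B" for B x
    using that unfolding p_def by (induction B rule: finite_induct) (auto simp: rademacher_alt indicator_def)
  have p_le: "cmod (p B x) \<le> 1" if "finite B" for B x by (simp add: p_ind[OF that] indicator_def)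
  have step: "(\<integral>x. walsh C x * p B x * h x \<partial>haar_X) = 0" if "finite B" "finite C" for B C
    using that
  proof (induction B arbitrary: C rule: finite_induct)
    case empty
    then show ?case using coeff[of C] by (simp add: p_def)
  next
    case (insert k B)
    obtain C' where C': "finite C'" "\<And>x. rademacher k x * walsh C x = walsh C' x"
      using walsh_times_rademacher[OF insert.prems] by metis
    have i: "integrable haar_X (\<lambda>x. walsh D x * p B x * h x)" for D
      by (rule int) (auto simp: norm_mult p_le insert.hyps)
    have eq: "walsh C x * p (insert k B) x * h x =
        (1/2) * (walsh C x * p B x * h x - walsh C' x * p B x * h x)" for x
      unfolding C'(2)[symmetric] using insert.hyps by (simp add: p_def field_simps)
    show ?case
      unfolding eq using insert.IH[OF insert.prems] insert.IH[OF C'(1)]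
      by (simp add: i Bochner_Integration.integral_diff)
  qed
  have ind: "(\<integral>x. indicator A x * h x \<partial>haar_X) = 0" if "A \<in> sets haar_X" for A
  proof -
    let ?G = "{{x::cantor. \<forall>j\<in>B. x j} | B. finite B}"
    have "Int_stable ?G"
    proof (rule Int_stableI)
      fix a b assume "a \<in> ?G" "b \<in> ?G"
      then obtain F H where F: "a = {x. \<forall>j\<in>F. x j}" "b = {x. \<forall>j\<in>H. x j}" "finite F" "finite H"
        by auto
      then have "a \<inter> b = {x. \<forall>j\<in>F \<union> H. x j}" by auto
      then show "a \<inter> b \<in> ?G" using F(3,4) by blast
    qed
    moreover have "?G \<subseteq> Pow UNIV" by simp
    moreover have "A \<in> sigma_sets UNIV ?G" using that by (simp only: sets_haar_X_generated)
    ultimately show ?thesis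
    proof (induction rule: sigma_sets_induct_disjoint)
      case (basic A)
      then obtain F where A: "A = {x. \<forall>j\<in>F. x j}" "finite F" by auto
      show ?case using step[OF A(2), of "{}"] unfolding A(1) by (simp add: p_ind[OF A(2)])
    next
      case (compl A)
      then have [measurable]: "A \<in> sets haar_X" by (simp add: sets_haar_X_generated)
      have "indicator (UNIV - A) x * h x = h x - indicator A x * h x" for x
        by (simp add: indicator_def)
      moreover have "(\<integral>x. h x \<partial>haar_X) = 0" using coeff[of "{}"] by simp
      moreover have "integrable haar_X (\<lambda>x. indicator A x * h x)"
        by (rule int) (auto simp: indicator_def)
      ultimately show ?case using compl h by simp
    next
      case (union A)
      then have A [measurable]: "\<And>i. A i \<in> sets haar_X" by (auto simp: sets_haar_X_generated)
      have eq: "set_lebesgue_integral haar_X B h = (\<integral>x. indicator B x * h x \<partial>haar_X)" for B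
        unfolding set_lebesgue_integral_def
        by (intro Bochner_Integration.integral_cong) (auto simp: indicator_def)
      have "set_lebesgue_integral haar_X (\<Union>i. A i) h = suminf (\<lambda>i. set_lebesgue_integral haar_X (A i) h)"
      proof (rule lebesgue_integral_countable_add)
        show "A i \<inter> A j = {}" if "i \<noteq> j" for i j
          using union(1) that by (auto simp: disjoint_family_on_def)
        show "set_integrable haar_X (\<Union>i. A i) h"
          unfolding set_integrable_def using h by (intro integrable_mult_indicator) auto
      qed measurable
      then show ?case using union(3) by (simp add: eq)
    qed simp_all
  qed
  have "AE x in haar_X. h x = (\<lambda>_. 0) x"
  proof (rule haar.density_unique_banach[OF h])
    fix A assume "A \<in> sets haar_X"
    have "set_lebesgue_integral haar_X A h = (\<integral>x. indicator A x * h x \<partial>haar_X)"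
      unfolding set_lebesgue_integral_def
      by (intro Bochner_Integration.integral_cong) (auto simp: indicator_def)
    then show "set_lebesgue_integral haar_X A h = set_lebesgue_integral haar_X A (\<lambda>_. 0)"
      using ind[OF \<open>A \<in> sets haar_X\<close>] by (simp add: set_lebesgue_integral_def)
  qed simp
  then show ?thesis by simp
qed

text \<open>
  Zero-one law. Translation by \<open>\<delta>\<^sub>l\<close> with \<open>l \<in> B\<close> reverses the sign of the Walsh function of \<open>B\<close>, so the
  indicator of an invariant set has the Walsh coefficients of a constant.
\<close>

lemma translation_invariant_zero_one:
  assumes S [measurable]: "S \<in> sets haar_X"
    and inv: "\<And>x k. x \<oplus>\<^sub>X delta k \<in> S \<longleftrightarrow> x \<in> S"
  shows "(AE x in haar_X. x \<in> S) \<or> (AE x in haar_X. x \<notin> S)"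
proof -
  define c where "c = (\<integral>x. (indicator S x :: complex) \<partial>haar_X)"
  have int: "integrable haar_X (\<lambda>x. indicator S x :: complex)"
    by (rule haar.integrable_const_bound[of _ 1]) (auto simp: indicator_def)
  have ae: "AE x in haar_X. indicator S x - c = 0"
  proof (rule walsh_complete)
    show "integrable haar_X (\<lambda>x. indicator S x - c)" using int by simp
    fix B :: "nat set" assume B: "finite B"
    show "(\<integral>x. walsh B x * (indicator S x - c) \<partial>haar_X) = 0"
    proof (cases "B = {}")
      case True
      then show ?thesis using int by (simp add: c_def haar.prob_space[simplified])
    next
      case False
      then obtain l where l: "l \<in> B" by auto
      have "(\<integral>x. walsh B x * (indicator S x - c) \<partial>haar_X) =
          (\<integral>x. walsh B (x \<oplus>\<^sub>X delta l) * (indicator S (x \<oplus>\<^sub>X delta l) - c) \<partial>haar_X)"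
        by (rule integral_haar_translate[symmetric]) measurable
      also have "\<dots> = (\<integral>x. - (walsh B x * (indicator S x - c)) \<partial>haar_X)"
        using l B by (intro Bochner_Integration.integral_cong) (auto simp: walsh_delta inv indicator_def)
      finally show ?thesis by simp
    qed
  qed
  have c: "AE x in haar_X. x \<in> S \<longrightarrow> c = 1" "AE x in haar_X. x \<notin> S \<longrightarrow> c = 0"
    by (rule eventually_mono[OF ae], force)+
  show ?thesis
  proof (cases "c = 1")
    case True
    then show ?thesis using c(2) by simp
  next
    case False
    then show ?thesis using c(1) by simp
  qed
qed

section \<open>Separability of $L_2(X)$\<close>

lemma subspace_closure:
  fixes S :: "'a::real_normed_vector set"
  assumes "subspace S"
  shows "subspace (closure S)"
proof (rule subspaceI)
  show "0 \<in> closure S" using subspace_0[OF assms] closure_subset by blast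
next
  fix x y assume "x \<in> closure S" "y \<in> closure S"
  then obtain f g where "\<forall>n. f n \<in> S" "f \<longlonglongrightarrow> x" "\<forall>n. g n \<in> S" "g \<longlonglongrightarrow> y"
    by (auto simp: closure_sequential)
  then show "x + y \<in> closure S"
    unfolding closure_sequential using subspace_add[OF assms]
    by (intro exI[of _ "\<lambda>n. f n + g n"]) (auto intro: tendsto_add)
next
  fix c x assume "x \<in> closure S"
  then obtain f where "\<forall>n. f n \<in> S" "f \<longlonglongrightarrow> x" by (auto simp: closure_sequential)
  then show "c *\<^sub>R x \<in> closure S"
    unfolding closure_sequential using subspace_scale[OF assms]
    by (intro exI[of _ "\<lambda>n. c *\<^sub>R f n"]) (auto intro: tendsto_scaleR)
qed

lemma separable_span:
  fixes b :: "nat \<Rightarrow> 'a::real_normed_vector"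
  shows "\<exists>D. countable D \<and> span (range b) \<subseteq> closure D"
proof -
  \<comment> \<open>The range of \<open>f\<close> consists of the rational linear combinations.\<close>
  define f where "f l = (\<Sum>(q, n)\<leftarrow>l. of_rat q *\<^sub>R b n)" for l :: "(rat \<times> nat) list"
  have "x \<in> closure (range f)" if "x \<in> span (range b)" for x
    using that
  proof (induction rule: span_induct_alt)
    case base
    have "f [] \<in> closure (range f)" by (rule subsetD[OF closure_subset]) simp
    then show ?case by (simp add: f_def)
  next
    case (step c x y)
    then obtain n where n: "x = b n" by auto
    show ?case
      unfolding closure_approachable
    proof (intro allI impI)
      fix e :: real assume e: "0 < e"
      obtain l where l: "dist (f l) y < e / 2"
        using step(2) e unfolding closure_approachable by (metis half_gt_zero rangeE)
      define t where "t = e / (2 * (norm x + 1))"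
      have "0 < t" using e by (simp add: t_def add_nonneg_pos)
      then obtain q where q: "c - t < of_rat q" "of_rat q < c + t"
        using of_rat_dense[of "c - t" "c + t"] by auto
      have "norm ((of_rat q - c) *\<^sub>R x) \<le> t * norm x" using q by (simp add: mult_right_mono)
      also have "\<dots> \<le> t * (norm x + 1)" using \<open>0 < t\<close> by (simp add: mult_left_mono)
      also have "\<dots> = e / 2"
      proof -
        have cancel: "e / (2 * N) * N = e / 2" if "0 < N" for N :: real using that by simp
        have "0 < norm x + 1" by (simp add: add_nonneg_pos)
        from cancel[OF this] show ?thesis unfolding t_def .
      qed
      finally have "norm ((of_rat q - c) *\<^sub>R x) \<le> e / 2" .
      moreover have "norm (f l - y) < e / 2" using l by (simp add: dist_norm)
      moreover have "f ((q, n) # l) - (c *\<^sub>R x + y) = (of_rat q - c) *\<^sub>R x + (f l - y)"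
        by (simp add: f_def n scaleR_diff_left)
      ultimately have "norm (f ((q, n) # l) - (c *\<^sub>R x + y)) < e"
        using norm_triangle_ineq[of "(of_rat q - c) *\<^sub>R x" "f l - y"]
        by (simp only:)
      then have "dist (f ((q, n) # l)) (c *\<^sub>R x + y) < e" by (simp add: dist_norm)
      then show "\<exists>z\<in>range f. dist z (c *\<^sub>R x + y) < e" by blast
    qed
  qed
  then show ?thesis by (intro exI[of _ "range f"]) auto
qed

lemma square_integrable_walsh: "square_integrable (walsh B)"
  by (rule square_integrable_bounded) simp_all

text \<open>The Walsh functions and their multiples by \<open>\<i>\<close> have dense real span.\<close>

lemma L2X_separable: "\<exists>D :: L2X set. countable D \<and> closure D = UNIV"
proof -
  define B where "B = (\<lambda>A. abs_L2X (walsh A)) ` {A. finite A} \<union>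
    (\<lambda>A. abs_L2X (\<lambda>x. \<i> * walsh A x)) ` {A. finite A}"
  have "countable B" unfolding B_def by (auto intro: countable_Collect_finite)
  moreover have "B \<noteq> {}" by (auto simp: B_def)
  ultimately obtain b :: "nat \<Rightarrow> L2X" where b: "B = range b" by (metis uncountable_def)
  let ?W = "closure (span (range b))"
  have "v \<in> ?W" for v
  proof -
    obtain w where w: "w \<in> ?W" "\<forall>u\<in>?W. (v - w) \<bullet> u = 0"
      using orthogonal_projection_exists[of ?W v] by (auto simp: complete_eq_closed intro: subspace_closure)
    obtain h where h: "square_integrable h" "v - w = abs_L2X h" by (rule L2X_cases)
    have orth: "(v - w) \<bullet> u = 0" if "u \<in> B" for u
    proof -
      have "u \<in> ?W" using that b by (intro subsetD[OF closure_subset] span_base) simp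
      then show ?thesis using w(2) by blast
    qed
    have "(\<integral>x. walsh A x * h x \<partial>haar_X) = 0" if A: "finite A" for A
    proof -
      have "(\<integral>x. walsh A x * h x \<partial>haar_X) = herm_L2X (v - w) (abs_L2X (walsh A))" (is "?I = _")
        by (simp add: h abs_L2X_herm square_integrable_walsh mult.commute)
      moreover have "scaleC_L2X \<i> (abs_L2X (walsh A)) = abs_L2X (\<lambda>x. \<i> * walsh A x)"
        by (rule abs_L2X_scaleC) (rule square_integrable_walsh)
      ultimately have "Re ?I = (v - w) \<bullet> abs_L2X (walsh A)"
        "Im ?I = (v - w) \<bullet> abs_L2X (\<lambda>x. \<i> * walsh A x)"
        by (simp_all add: Re_herm_L2X Im_herm_L2X)
      then show ?thesis using orth A by (auto simp: B_def complex_eq_iff)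
    qed
    then have "AE x in haar_X. h x = 0"
      by (intro walsh_complete square_integrable_integrable h)
    then have "v - w = 0" using h by (simp add: abs_L2X_eq_0_iff)
    then show ?thesis using w(1) by simp
  qed
  moreover obtain D where "countable D" "span (range b) \<subseteq> closure D" using separable_span by blast
  ultimately show ?thesis by (metis UNIV_eq_I closure_closure closure_mono in_mono)
qed

section \<open>The operators of the basis vectors\<close>

text \<open>For even \<open>k\<close>, the index of the entry on which \<open>c k\<close> depends; a fixed-point free involution.\<close>

definition partner :: "nat \<Rightarrow> nat" where
  "partner k = (if k mod 4 = 0 then k + 2 else k - 2)"

lemma c_fun_alt: "c_fun k x = (if odd k then 1 else rademacher (partner k) x)"
  by (simp add: c_fun_def partner_def rademacher_def)

lemma partner_props:
  assumes "even k"
  shows "even (partner k)" "partner k \<noteq> k" "partner (partner k) = k"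
proof -
  from assms have "k mod 4 = 0 \<or> k mod 4 = 2" by presburger
  then have *: "even (partner k) \<and> partner k \<noteq> k \<and> partner (partner k) = k"
  proof
    assume a: "k mod 4 = 0"
    then have "(k + 2) mod 4 = 2" by presburger
    then show ?thesis using a assms by (simp add: partner_def)
  next
    assume a: "k mod 4 = 2"
    then have "(k - 2) mod 4 = 0" "k \<ge> 2" by presburger+
    then show ?thesis using a assms by (simp add: partner_def) arith
  qed
  show "even (partner k)" "partner k \<noteq> k" "partner (partner k) = k" using * by auto
qed

lemma c_fun_measurable [measurable]: "c_fun k \<in> borel_measurable haar_X"
  unfolding c_fun_alt by measurable

lemma cmod_c_fun [simp]: "cmod (c_fun k x) = 1"
  by (simp add: c_fun_alt)

lemma cnj_c_fun [simp]: "cnj (c_fun k x) = c_fun k x"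
  by (simp add: c_fun_alt)

lemma c_fun_delta:
  "c_fun k (x \<oplus>\<^sub>X delta l) = (if even k \<and> l = partner k then - c_fun k x else c_fun k x)"
  by (auto simp: c_fun_alt rademacher_delta)

lemma c_fun_delta_self: "c_fun k (x \<oplus>\<^sub>X delta k) = c_fun k x"
  using partner_props(2)[of k] by (auto simp: c_fun_delta)

lemma c_fun_cocycle:
  "c_fun k x * c_fun l (x \<oplus>\<^sub>X delta k) = c_fun l x * c_fun k (x \<oplus>\<^sub>X delta l)"
  using partner_props[of k] partner_props[of l] by (auto simp: c_fun_delta)

lemma c_fun_xcompl: "c_fun k (xcompl x) = (-1) ^ (k + 1) * c_fun k x"
  by (simp add: c_fun_alt rademacher_xcompl)

text \<open>
  The operators for \<open>e k\<close> and \<open>\<sigma> (e k)\<close> are listed as one sequence, at the positions \<open>2 * k\<close> and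
  \<open>2 * k + 1\<close>; the one at position \<open>n\<close> is \<open>f \<mapsto> phase n \<cdot> f(\<cdot> + \<delta>\<^sub>k)\<close> with \<open>k = n div 2\<close>.
\<close>

definition phase :: "nat \<Rightarrow> cantor \<Rightarrow> complex" where
  "phase n x = (if even n then - \<i> else rademacher (n div 2) x) *
     walsh {..<n div 2} x * c_fun (n div 2) x"

lemma measurable_phase [measurable]: "phase n \<in> borel_measurable haar_X"
  unfolding phase_def by measurable

lemma cmod_phase [simp]: "cmod (phase n x) = 1"
  by (simp add: phase_def norm_mult)

lemma cnj_phase: "cnj (phase n x) = - phase n (x \<oplus>\<^sub>X delta (n div 2))"
  by (simp add: phase_def c_fun_delta_self rademacher_delta walsh_delta)

lemma phase_anticommute:
  assumes "m \<noteq> n"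
  shows "phase m x * phase n (x \<oplus>\<^sub>X delta (m div 2)) = - (phase n x * phase m (x \<oplus>\<^sub>X delta (n div 2)))"
proof -
  define p where "p n x = (if even n then - \<i> else rademacher (n div 2) x)" for n :: nat and x
  let ?k = "m div 2" and ?l = "n div 2"
  have phase: "phase n x = p n x * walsh {..<n div 2} x * c_fun (n div 2) x" for n x
    by (simp add: phase_def p_def)
  have p: "p n (x \<oplus>\<^sub>X delta l) = (if odd n \<and> l = n div 2 then - p n x else p n x)" for n l
    by (auto simp: p_def rademacher_delta)
  have w: "walsh {..<j} (x \<oplus>\<^sub>X delta l) = (if l < j then - walsh {..<j} x else walsh {..<j} x)" for j l
    by (simp add: walsh_delta)
  have c: "c_fun ?k x * c_fun ?l (x \<oplus>\<^sub>X delta ?k) = c_fun ?l x * c_fun ?k (x \<oplus>\<^sub>X delta ?l)"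
    by (rule c_fun_cocycle)
  \<comment> \<open>Without the factors \<open>c\<close> the sign comes from \<open>p\<close> if the two sites agree, and otherwise from the
    Walsh function that contains the smaller site.\<close>
  have s: "p m x * walsh {..<?k} x * (p n (x \<oplus>\<^sub>X delta ?k) * walsh {..<?l} (x \<oplus>\<^sub>X delta ?k)) =
    - (p n x * walsh {..<?l} x * (p m (x \<oplus>\<^sub>X delta ?l) * walsh {..<?k} (x \<oplus>\<^sub>X delta ?l)))"
  proof (cases "?k = ?l")
    case True
    then have "odd m \<noteq> odd n" using assms by (metis even_two_times_div_two odd_two_times_div_two_succ)
    then show ?thesis using True by (auto simp: p w)
  next
    case False
    then show ?thesis by (cases "?k < ?l") (auto simp: p w)
  qed
  have "phase m x * phase n (x \<oplus>\<^sub>X delta ?k) =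
    (p m x * walsh {..<?k} x * (p n (x \<oplus>\<^sub>X delta ?k) * walsh {..<?l} (x \<oplus>\<^sub>X delta ?k))) *
    (c_fun ?k x * c_fun ?l (x \<oplus>\<^sub>X delta ?k))"
    by (simp add: phase)
  also have "\<dots> = - (phase n x * phase m (x \<oplus>\<^sub>X delta ?l))"
    unfolding s c by (simp add: phase)
  finally show ?thesis .
qed

lemma phase_xcompl: "phase n (xcompl x) = cnj (phase n x)"
  by (simp add: phase_def rademacher_xcompl walsh_xcompl c_fun_xcompl)

text \<open>The operator of the basis vector at position \<open>n\<close>.\<close>

lift_definition generator :: "nat \<Rightarrow> L2X \<Rightarrow> L2X" is
  "\<lambda>n f x. phase n x * f (x \<oplus>\<^sub>X delta (n div 2))"
proof (intro conjI)
  fix n f g assume fg: "square_integrable f \<and> square_integrable g \<and> (AE x in haar_X. f x = g x)"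
  show "square_integrable (\<lambda>x. phase n x * f (x \<oplus>\<^sub>X delta (n div 2)))"
    "square_integrable (\<lambda>x. phase n x * g (x \<oplus>\<^sub>X delta (n div 2)))"
    using fg by (auto intro!: square_integrable_bounded_mult square_integrable_translate)
  have "AE x in haar_X. f (x \<oplus>\<^sub>X delta (n div 2)) = g (x \<oplus>\<^sub>X delta (n div 2))"
    using fg by (intro AE_haar_translate) auto
  then show "AE x in haar_X. phase n x * f (x \<oplus>\<^sub>X delta (n div 2)) =
      phase n x * g (x \<oplus>\<^sub>X delta (n div 2))"
    by (rule eventually_mono) simp
qed

lemma generator_abs:
  "square_integrable f \<Longrightarrow>
    generator n (abs_L2X f) = abs_L2X (\<lambda>x. phase n x * f (x \<oplus>\<^sub>X delta (n div 2)))"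
  by (rule generator.abs_eq) simp

lemma square_integrable_generator:
  "square_integrable f \<Longrightarrow> square_integrable (\<lambda>x. phase n x * f (x \<oplus>\<^sub>X delta l))"
  by (auto intro!: square_integrable_bounded_mult square_integrable_translate)

lemma xadd_delta_delta: "x \<oplus>\<^sub>X delta k \<oplus>\<^sub>X delta k = x"
  by (auto simp: xadd_def)

lemma xadd_delta_commute: "x \<oplus>\<^sub>X delta k \<oplus>\<^sub>X delta l = x \<oplus>\<^sub>X delta l \<oplus>\<^sub>X delta k"
  by (auto simp: xadd_def)

lemma generator_add: "generator n (F + G) = generator n F + generator n G"
proof -
  obtain f where f: "square_integrable f" "F = abs_L2X f" by (rule L2X_cases)
  obtain g where g: "square_integrable g" "G = abs_L2X g" by (rule L2X_cases)
  show ?thesis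
    by (simp add: f g abs_L2X_plus generator_abs square_integrable_add square_integrable_generator distrib_left)
qed

lemma generator_scaleC: "generator n (scaleC_L2X c F) = scaleC_L2X c (generator n F)"
proof -
  obtain f where f: "square_integrable f" "F = abs_L2X f" by (rule L2X_cases)
  show ?thesis
    by (simp add: f abs_L2X_scaleC generator_abs square_integrable_cmult square_integrable_generator mult.left_commute)
qed

lemma linear_generator: "linear (generator n)"
  by (rule linearI) (simp_all add: generator_add scaleR_L2X_def generator_scaleC)

lemma generator_square: "generator n (generator n F) = - F"
proof -
  obtain f where f: "square_integrable f" "F = abs_L2X f" by (rule L2X_cases)
  let ?d = "delta (n div 2)"
  have "phase n x * phase n (x \<oplus>\<^sub>X ?d) = -1" for x
  proof -
    have "phase n x * phase n (x \<oplus>\<^sub>X ?d) = - (phase n x * cnj (phase n x))" by (simp add: cnj_phase)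
    then show ?thesis by (simp add: complex_norm_square[symmetric])
  qed
  then have "phase n x * (phase n (x \<oplus>\<^sub>X ?d) * f x) = - f x" for x
    by (simp add: mult.assoc[symmetric])
  then show ?thesis
    by (simp add: f generator_abs square_integrable_generator xadd_delta_delta abs_L2X_uminus)
qed

lemma generator_anticommute:
  assumes "m \<noteq> n"
  shows "generator m (generator n F) = - generator n (generator m F)"
proof -
  obtain f where f: "square_integrable f" "F = abs_L2X f" by (rule L2X_cases)
  have "phase m x * (phase n (x \<oplus>\<^sub>X delta (m div 2)) * f (x \<oplus>\<^sub>X delta (m div 2) \<oplus>\<^sub>X delta (n div 2))) =
    - (phase n x * (phase m (x \<oplus>\<^sub>X delta (n div 2)) * f (x \<oplus>\<^sub>X delta (n div 2) \<oplus>\<^sub>X delta (m div 2))))" for x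
    using phase_anticommute[OF assms, of x] xadd_delta_commute[of x "m div 2" "n div 2"]
    by (simp add: mult.assoc[symmetric])
  moreover have "square_integrable (\<lambda>x. phase n x *
      (phase m (x \<oplus>\<^sub>X delta (n div 2)) * f (x \<oplus>\<^sub>X delta (n div 2) \<oplus>\<^sub>X delta (m div 2))))"
    using square_integrable_generator[OF square_integrable_generator[OF f(1)]] .
  ultimately show ?thesis
    by (simp add: f generator_abs square_integrable_generator abs_L2X_uminus)
qed

lemma herm_generator: "herm_L2X (generator n F) G = - herm_L2X F (generator n G)"
proof -
  obtain f where f: "square_integrable f" "F = abs_L2X f" by (rule L2X_cases)
  obtain g where g: "square_integrable g" "G = abs_L2X g" by (rule L2X_cases)
  have [measurable]: "f \<in> borel_measurable haar_X" "g \<in> borel_measurable haar_X"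
    using f g by (simp_all add: square_integrable_measurable)
  let ?d = "delta (n div 2)"
  let ?h = "\<lambda>x. phase n x * f (x \<oplus>\<^sub>X ?d) * cnj (g x)"
  have [measurable]: "(\<lambda>x. f (x \<oplus>\<^sub>X ?d)) \<in> borel_measurable haar_X"
    using f square_integrable_translate square_integrable_measurable by blast
  have "herm_L2X (generator n F) G = (\<integral>x. ?h x \<partial>haar_X)"
    by (simp add: f g generator_abs abs_L2X_herm square_integrable_generator)
  also have "\<dots> = (\<integral>x. ?h (x \<oplus>\<^sub>X ?d) \<partial>haar_X)"
    by (rule integral_haar_translate[symmetric]) measurable
  also have "\<dots> = (\<integral>x. - (f x * cnj (phase n x * g (x \<oplus>\<^sub>X ?d))) \<partial>haar_X)"
    by (intro Bochner_Integration.integral_cong) (simp_all add: xadd_delta_delta cnj_phase)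
  also have "\<dots> = - herm_L2X F (generator n G)"
    by (simp add: f g generator_abs abs_L2X_herm square_integrable_generator)
  finally show ?thesis .
qed

section \<open>The real form of $L_2(X)$\<close>

lemma xcompl_alt: "xcompl x = x \<oplus>\<^sub>X (\<lambda>_. True)"
  by (simp add: xcompl_def xadd_def)

lemma square_integrable_conj:
  assumes "square_integrable f"
  shows "square_integrable (\<lambda>x. cnj (f (xcompl x)))"
proof -
  have cnj: "square_integrable (\<lambda>x. cnj (h x))" if "square_integrable h" for h
    using that by (auto simp: square_integrable_def)
  show ?thesis using assms by (simp add: xcompl_alt cnj square_integrable_translate)
qed

text \<open>The conjugation of \<open>L\<^sub>2(X)\<close> whose fixed points form the real subspace.\<close>

lift_definition conj_L2X :: "L2X \<Rightarrow> L2X" is "\<lambda>f x. cnj (f (xcompl x))"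
proof -
  fix f g assume fg: "square_integrable f \<and> square_integrable g \<and> (AE x in haar_X. f x = g x)"
  then have "AE x in haar_X. f (xcompl x) = g (xcompl x)"
    unfolding xcompl_alt by (intro AE_haar_translate) auto
  then show "square_integrable (\<lambda>x. cnj (f (xcompl x))) \<and> square_integrable (\<lambda>x. cnj (g (xcompl x))) \<and>
      (AE x in haar_X. cnj (f (xcompl x)) = cnj (g (xcompl x)))"
    using fg by (auto intro: square_integrable_conj)
qed

lemma conj_L2X_abs:
  "square_integrable f \<Longrightarrow> conj_L2X (abs_L2X f) = abs_L2X (\<lambda>x. cnj (f (xcompl x)))"
  by (rule conj_L2X.abs_eq) simp

lemma xcompl_xcompl [simp]: "xcompl (xcompl x) = x"
  by (simp add: xcompl_def)

lemma xcompl_xadd: "xcompl (x \<oplus>\<^sub>X y) = xcompl x \<oplus>\<^sub>X y"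
  by (auto simp: xcompl_def xadd_def)

lemma conj_L2X_conj [simp]: "conj_L2X (conj_L2X F) = F"
proof -
  obtain f where f: "square_integrable f" "F = abs_L2X f" by (rule L2X_cases)
  then show ?thesis by (simp add: conj_L2X_abs square_integrable_conj)
qed

lemma conj_L2X_add: "conj_L2X (F + G) = conj_L2X F + conj_L2X G"
proof -
  obtain f where f: "square_integrable f" "F = abs_L2X f" by (rule L2X_cases)
  obtain g where g: "square_integrable g" "G = abs_L2X g" by (rule L2X_cases)
  show ?thesis
    by (simp add: f g abs_L2X_plus conj_L2X_abs square_integrable_add square_integrable_conj)
qed

lemma conj_L2X_scaleC: "conj_L2X (scaleC_L2X c F) = scaleC_L2X (cnj c) (conj_L2X F)"
proof -
  obtain f where f: "square_integrable f" "F = abs_L2X f" by (rule L2X_cases)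
  show ?thesis
    by (simp add: f abs_L2X_scaleC conj_L2X_abs square_integrable_cmult square_integrable_conj)
qed

lemma herm_conj_L2X: "herm_L2X (conj_L2X F) (conj_L2X G) = cnj (herm_L2X F G)"
proof -
  obtain f where f: "square_integrable f" "F = abs_L2X f" by (rule L2X_cases)
  obtain g where g: "square_integrable g" "G = abs_L2X g" by (rule L2X_cases)
  have [measurable]: "f \<in> borel_measurable haar_X" "g \<in> borel_measurable haar_X"
    using f g by (simp_all add: square_integrable_measurable)
  have "herm_L2X (conj_L2X F) (conj_L2X G) = (\<integral>x. cnj (f (xcompl x) * cnj (g (xcompl x))) \<partial>haar_X)"
    by (simp add: f g conj_L2X_abs abs_L2X_herm square_integrable_conj)
  also have "\<dots> = (\<integral>x. cnj (f x * cnj (g x)) \<partial>haar_X)"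
    unfolding xcompl_alt
    by (rule integral_haar_translate[where f = "\<lambda>x. cnj (f x * cnj (g x))"]) measurable
  also have "\<dots> = cnj (\<integral>x. f x * cnj (g x) \<partial>haar_X)"
    using f g by (intro integral_bounded_linear[OF bounded_linear_cnj] square_integrable_mult)
  finally show ?thesis using f g by (simp add: abs_L2X_herm)
qed

lemma bounded_linear_conj_L2X: "bounded_linear conj_L2X"
proof (rule bounded_linear_intro[where K = 1])
  show "conj_L2X (F + G) = conj_L2X F + conj_L2X G" for F G by (rule conj_L2X_add)
  show "conj_L2X (r *\<^sub>R F) = r *\<^sub>R conj_L2X F" for r F
    by (simp add: scaleR_L2X_def conj_L2X_scaleC)
  show "norm (conj_L2X F) \<le> norm F * 1" for F
    by (simp add: norm_L2X_def inner_L2X_def herm_conj_L2X)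
qed

lemma L2X_real_iff: "F \<in> L2X_real \<longleftrightarrow> conj_L2X F = F"
proof -
  let ?f = "fun_of F"
  have sq: "square_integrable ?f" by (rule square_integrable_fun_of)
  have "conj_L2X F = abs_L2X (\<lambda>x. cnj (?f (xcompl x)))"
    using conj_L2X_abs[OF sq] by simp
  then have "conj_L2X F = F \<longleftrightarrow> abs_L2X (\<lambda>x. cnj (?f (xcompl x)) - ?f x) = 0"
    using abs_L2X_diff[OF square_integrable_conj[OF sq] sq] by (metis abs_fun_of right_minus_eq)
  also have "\<dots> \<longleftrightarrow> (AE x in haar_X. cnj (?f (xcompl x)) - ?f x = 0)"
    by (rule abs_L2X_eq_0_iff) (intro square_integrable_diff square_integrable_conj sq)
  also have "\<dots> \<longleftrightarrow> F \<in> L2X_real"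
    unfolding L2X_real_def mem_Collect_eq
    by (rule arg_cong[where f = "\<lambda>P. AE x in haar_X. P x"]) (auto simp: fun_eq_iff complex_eq_iff)
  finally show ?thesis by blast
qed

lemma generator_conj: "generator n (conj_L2X F) = conj_L2X (generator n F)"
proof -
  obtain f where f: "square_integrable f" "F = abs_L2X f" by (rule L2X_cases)
  then show ?thesis
    by (simp add: generator_abs conj_L2X_abs square_integrable_conj square_integrable_generator
      phase_xcompl xcompl_xadd)
qed

lemma subspace_L2X_real: "subspace L2X_real"
  by (rule subspaceI) (simp_all add: L2X_real_iff linear_0 linear_add linear_scale
      bounded_linear.linear[OF bounded_linear_conj_L2X])

lemma closed_L2X_real: "closed L2X_real"
proof -
  have "closed {F. conj_L2X F = F}"
    by (intro closed_Collect_eq linear_continuous_on bounded_linear_conj_L2X continuous_on_id)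
  moreover have "{F. conj_L2X F = F} = L2X_real" using L2X_real_iff by auto
  ultimately show ?thesis by metis
qed

lemma herm_L2X_real:
  assumes "F \<in> L2X_real" "G \<in> L2X_real"
  shows "herm_L2X F G = of_real (F \<bullet> G)"
proof -
  have "cnj (herm_L2X F G) = herm_L2X F G"
    using herm_conj_L2X[of F G] assms by (simp add: L2X_real_iff)
  then show ?thesis by (simp add: complex_eq_iff inner_L2X_def)
qed

lemma L2X_real_separable: "\<exists>D. countable D \<and> D \<subseteq> L2X_real \<and> L2X_real \<subseteq> closure D"
proof -
  \<comment> \<open>The orthogonal projection onto the real subspace, which maps dense sets to dense sets.\<close>
  define P where "P F = (1/2) *\<^sub>R (F + conj_L2X F)" for F
  have lin: "linear conj_L2X" using bounded_linear_conj_L2X by (rule bounded_linear.linear)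
  obtain D :: "L2X set" where D: "countable D" "closure D = UNIV" using L2X_separable by blast
  have cont: "continuous_on UNIV P"
    unfolding P_def by (intro continuous_intros linear_continuous_on bounded_linear_conj_L2X)
  have "P F \<in> L2X_real" for F
    by (simp add: P_def L2X_real_iff linear_add[OF lin] linear_scale[OF lin] add.commute)
  moreover have "P F = F" if "F \<in> L2X_real" for F
    using that by (simp add: P_def L2X_real_iff scaleR_2[symmetric])
  moreover have "P ` closure D \<subseteq> closure (P ` D)"
    using cont D(2) by (intro image_closure_subset) (auto intro: subsetD[OF closure_subset])
  ultimately show ?thesis using D by (intro exI[of _ "P ` D"]) (auto simp: image_subset_iff, metis)
qed

lemma one_in_L2X_real: "abs_L2X (\<lambda>_. 1) \<in> L2X_real" "abs_L2X (\<lambda>_. 1) \<noteq> 0"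
proof -
  have sq: "square_integrable (\<lambda>_. 1)" by (rule square_integrable_const)
  show "abs_L2X (\<lambda>_. 1) \<in> L2X_real" by (simp add: L2X_real_iff conj_L2X_abs sq)
  show "abs_L2X (\<lambda>_. 1) \<noteq> 0" using abs_L2X_eq_0_iff[OF sq] by simp
qed

section \<open>Orthogonality of orbits\<close>

text \<open>The sequence with entry 1 exactly at the indices in \<open>A\<close>.\<close>

definition fin_seq :: "nat set \<Rightarrow> cantor" where
  "fin_seq A = (\<lambda>k. k \<in> A)"

lemma xadd_fin_seq_empty [simp]: "x \<oplus>\<^sub>X fin_seq {} = x"
  by (simp add: xadd_def fin_seq_def)

lemma xadd_delta_fin_seq:
  "x \<oplus>\<^sub>X delta k \<oplus>\<^sub>X fin_seq A = x \<oplus>\<^sub>X fin_seq (if k \<in> A then A - {k} else insert k A)"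
  by (auto simp: xadd_def fin_seq_def delta_def fun_eq_iff)

text \<open>
  By completeness of the Walsh functions, the translates of \<open>f\<close> by finitely supported sequences are
  nonzero only where \<open>g\<close> is zero, up to null sets. The zero-one law applies to the union \<open>S\<close> of the
  supports of these translates.
\<close>

lemma orthogonal_translates:
  assumes f: "square_integrable f" and g: "square_integrable g"
    and orth: "\<And>A B. finite A \<Longrightarrow> finite B \<Longrightarrow>
      (\<integral>x. walsh B x * f (x \<oplus>\<^sub>X fin_seq A) * cnj (g x) \<partial>haar_X) = 0"
  shows "(AE x in haar_X. f x = 0) \<or> (AE x in haar_X. g x = 0)"
proof -
  have [measurable]: "f \<in> borel_measurable haar_X" using f by (rule square_integrable_measurable)
  have [measurable]: "(\<lambda>x. f (x \<oplus>\<^sub>X y)) \<in> borel_measurable haar_X" for y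
    using f square_integrable_translate square_integrable_measurable by blast
  have "AE x in haar_X. f (x \<oplus>\<^sub>X fin_seq A) * cnj (g x) = 0" if "finite A" for A
    using orth[OF that] f g
    by (intro walsh_complete square_integrable_mult square_integrable_translate)
      (simp_all add: mult.assoc)
  then have disjoint: "AE x in haar_X. \<forall>A\<in>{A. finite A}. f (x \<oplus>\<^sub>X fin_seq A) * cnj (g x) = 0"
    by (subst AE_ball_countable[OF countable_Collect_finite]) auto
  define S where "S = (\<Union>A\<in>{A. finite A}. {x \<in> space haar_X. f (x \<oplus>\<^sub>X fin_seq A) \<noteq> 0})"
  have S_iff: "x \<in> S \<longleftrightarrow> (\<exists>A. finite A \<and> f (x \<oplus>\<^sub>X fin_seq A) \<noteq> 0)" for x
    by (auto simp: S_def)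
  have "{x \<in> space haar_X. f (x \<oplus>\<^sub>X fin_seq A) \<noteq> 0} \<in> sets haar_X" for A by measurable
  then have "S \<in> sets haar_X"
    unfolding S_def by (intro sets.countable_UN'[OF countable_Collect_finite]) auto
  moreover have shift: "x \<in> S" if x: "x \<oplus>\<^sub>X delta k \<in> S" for x k
  proof -
    obtain A where "finite A" "f (x \<oplus>\<^sub>X delta k \<oplus>\<^sub>X fin_seq A) \<noteq> 0" using x S_iff by blast
    then show ?thesis unfolding S_iff xadd_delta_fin_seq
      by (intro exI[of _ "if k \<in> A then A - {k} else insert k A"]) simp
  qed
  have "x \<oplus>\<^sub>X delta k \<in> S \<longleftrightarrow> x \<in> S" for x k
    using shift[of x k] shift[of "x \<oplus>\<^sub>X delta k" k] by (auto simp: xadd_delta_delta)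
  ultimately have "(AE x in haar_X. x \<in> S) \<or> (AE x in haar_X. x \<notin> S)"
    by (intro translation_invariant_zero_one)
  then show ?thesis
  proof
    assume "AE x in haar_X. x \<in> S"
    with disjoint have "AE x in haar_X. g x = 0"
      by eventually_elim (auto simp: S_iff)
    then show ?thesis ..
  next
    assume "AE x in haar_X. x \<notin> S"
    then have "AE x in haar_X. f x = 0"
      by (rule eventually_mono) (use S_iff in \<open>metis finite.emptyI xadd_fin_seq_empty\<close>)
    then show ?thesis ..
  qed
qed

lemma phase_odd: "phase (2 * k + 1) x = (-1) ^ of_bool (x k) * \<i> * phase (2 * k) x"
  by (simp add: phase_def rademacher_def[symmetric] ac_simps)

text \<open>
  A set \<open>V\<close> of vectors that is closed under the generators and under complex multiples is also closed
  under multiplication by Walsh functions and under translation by finitely supported sequences, so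
  that the preceding lemma applies to \<open>F\<close> and \<open>G\<close>.
\<close>

lemma generator_invariant_orthogonal:
  assumes inv: "\<And>n F. F \<in> V \<Longrightarrow> generator n F \<in> V"
    and scale: "\<And>c F. F \<in> V \<Longrightarrow> scaleC_L2X c F \<in> V"
    and orth: "\<And>F. F \<in> V \<Longrightarrow> herm_L2X F G = 0"
    and F: "F \<in> V"
  shows "F = 0 \<or> G = 0"
proof -
  define Q where "Q f \<longleftrightarrow> square_integrable f \<and> abs_L2X f \<in> V" for f
  have Q_gen: "Q (\<lambda>x. phase n x * f (x \<oplus>\<^sub>X delta (n div 2)))" if "Q f" for n f
    using that inv[of "abs_L2X f" n] by (simp add: Q_def generator_abs square_integrable_generator)
  have Q_scale: "Q (\<lambda>x. c * f x)" if "Q f" for c f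
    using that scale[of "abs_L2X f" c] by (simp add: Q_def abs_L2X_scaleC square_integrable_cmult)
  have Q_rad: "Q (\<lambda>x. rademacher k x * f x)" if "Q f" for k f
  proof -
    \<comment> \<open>Applying the generators \<open>2 * k\<close> and then \<open>2 * k + 1\<close> amounts to multiplication by \<open>- \<i>\<close> times
      the Rademacher function.\<close>
    have "\<i> * (phase (2 * k + 1) x * (phase (2 * k) (x \<oplus>\<^sub>X delta k) * f x)) = rademacher k x * f x" for x
    proof -
      have "phase (2 * k + 1) x = rademacher k x * \<i> * phase (2 * k) x"
        by (simp only: phase_odd rademacher_def)
      moreover have "phase (2 * k) x * phase (2 * k) (x \<oplus>\<^sub>X delta k) = -1"
        using complex_norm_square[of "phase (2 * k) x"] cnj_phase[of "2 * k" x]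
        by (simp add: minus_equation_iff)
      ultimately show ?thesis by (simp add: mult.assoc[symmetric])
    qed
    moreover have "Q (\<lambda>x. \<i> * (phase (2 * k + 1) x * (phase (2 * k) (x \<oplus>\<^sub>X delta k) * f x)))"
      using Q_scale[OF Q_gen[OF Q_gen[OF that, of "2 * k"], of "2 * k + 1"], of \<i>]
      by (simp add: xadd_delta_delta)
    ultimately show ?thesis by (simp only:)
  qed
  have Q_walsh: "Q (\<lambda>x. walsh B x * f x)" if "Q f" "finite B" for f B
    using that(2)
  proof (induction B rule: finite_induct)
    case (insert k B)
    then show ?case using Q_rad[OF insert.IH, of k] by (simp add: walsh_insert mult.assoc)
  qed (simp add: that(1))
  have Q_c: "Q (\<lambda>x. c_fun k x * f x)" if "Q f" for f k
    using that Q_rad[OF that, of "partner k"] by (cases "even k") (simp_all add: c_fun_alt)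
  have Q_delta: "Q (\<lambda>x. f (x \<oplus>\<^sub>X delta k))" if "Q f" for f k
  proof -
    \<comment> \<open>The phase of the generator \<open>2 * k\<close> is undone by a Walsh function, \<open>c k\<close> and a scalar.\<close>
    have "\<i> * (c_fun k x * (walsh {..<k} x * (phase (2 * k) x * y))) = y" for x y
    proof -
      have "c_fun k x * c_fun k x = 1" by (simp add: c_fun_alt rademacher_square)
      then have "\<i> * (c_fun k x * (walsh {..<k} x * (phase (2 * k) x * y))) =
          - (\<i> * \<i>) * (c_fun k x * c_fun k x) * (walsh {..<k} x * walsh {..<k} x) * y"
        by (simp add: phase_def ac_simps)
      then show ?thesis by (simp add: walsh_square \<open>c_fun k x * c_fun k x = 1\<close>)
    qed
    moreover have "Q (\<lambda>x. \<i> * (c_fun k x * (walsh {..<k} x * (phase (2 * k) x * f (x \<oplus>\<^sub>X delta k)))))"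
      using Q_gen[OF that, of "2 * k"] by (intro Q_scale Q_c Q_walsh) simp_all
    ultimately show ?thesis by (simp only:)
  qed
  have Q_fin: "Q (\<lambda>x. f (x \<oplus>\<^sub>X fin_seq A))" if "Q f" "finite A" for f A
    using that(2)
  proof (induction A rule: finite_induct)
    case (insert k A)
    from Q_delta[OF insert.IH, of k] insert.hyps show ?case by (simp add: xadd_delta_fin_seq)
  qed (simp add: that(1))
  obtain f where f: "square_integrable f" "F = abs_L2X f" by (rule L2X_cases)
  obtain g where g: "square_integrable g" "G = abs_L2X g" by (rule L2X_cases)
  have Qf: "Q f" using F f by (simp add: Q_def)
  have "(\<integral>x. walsh B x * f (x \<oplus>\<^sub>X fin_seq A) * cnj (g x) \<partial>haar_X) = 0" if "finite A" "finite B" for A B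
  proof -
    have q: "Q (\<lambda>x. walsh B x * f (x \<oplus>\<^sub>X fin_seq A))" by (intro Q_walsh Q_fin Qf that)
    then show ?thesis using orth[of "abs_L2X (\<lambda>x. walsh B x * f (x \<oplus>\<^sub>X fin_seq A))"] g
      by (simp add: Q_def abs_L2X_herm)
  qed
  then have "(AE x in haar_X. f x = 0) \<or> (AE x in haar_X. g x = 0)"
    by (intro orthogonal_translates f g)
  then show ?thesis by (simp add: f g abs_L2X_eq_0_iff)
qed

section \<open>Complex representations from Clifford actions\<close>

lemma complexify_add: "complexify (a + b) = complexify a + complexify b"
  by (simp add: complexify_def plus_complexified_def)

lemma complexify_mult:
  "complexify (a * b) = complexify a * complexify (b :: 'a::{real_algebra, monoid_mult})"
  by (simp add: complexify_def times_complexified_def)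

lemma complexify_scaleR:
  "complexify (r *\<^sub>R a) = cscale_complexified (of_real r) (complexify (a :: 'a::real_vector))"
  by (simp add: complexify_def cscale_complexified_def)

lemma complexify_one: "complexify 1 = (1 :: 'a::{real_algebra, monoid_mult} complexified)"
  by (simp add: complexify_def one_complexified_def)

lemma complexified_decompose:
  "c = complexify (re_part c) + cscale_complexified \<i> (complexify (im_part c))"
  by (cases c) (simp add: complexify_def plus_complexified_def cscale_complexified_def)

lemma scaleC_L2X_minus_one: "scaleC_L2X (-1) F = - F"
  by (simp add: uminus_L2X_def)

lemma scaleC_L2X_decompose: "scaleC_L2X c F = Re c *\<^sub>R F + Im c *\<^sub>R scaleC_L2X \<i> F"
proof -
  have "c = of_real (Re c) + of_real (Im c) * \<i>" by (simp add: complex_eq_iff)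
  then have "scaleC_L2X c F = scaleC_L2X (of_real (Re c) + of_real (Im c) * \<i>) F" by simp
  also have "\<dots> = Re c *\<^sub>R F + Im c *\<^sub>R scaleC_L2X \<i> F"
    unfolding scaleC_L2X_add_left scaleC_L2X_scaleC[symmetric] scaleC_L2X_of_real ..
  finally show ?thesis .
qed

lemma linear_scaleC_L2X: "linear (scaleC_L2X c)"
  by (rule bounded_linear.linear[OF bounded_linear_scaleC_L2X])

lemma complex_hilbert_space_L2X: "complex_hilbert_space_on UNIV scaleC_L2X herm_L2X"
proof unfold_locales
  show "\<exists>D :: L2X set. countable D \<and> D \<subseteq> UNIV \<and> UNIV \<subseteq> closure D"
    using L2X_separable by auto
  show "scaleC_L2X (of_real r) F = r *\<^sub>R F" for r F by (rule scaleC_L2X_of_real)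
qed (simp_all add: complete_UNIV scaleC_L2X_add_right scaleC_L2X_add_left scaleC_L2X_scaleC
  herm_L2X_add_left herm_L2X_scaleC_left herm_L2X_commute[symmetric] Re_herm_L2X)

text \<open>
  A skew-hermitian Clifford action by complex linear operators extends to the complexified Clifford
  algebra, on which \<open>a + i b\<close> acts by the sum of the operator of \<open>a\<close> and \<open>\<i>\<close> times that of \<open>b\<close>.
\<close>

lemma complex_rep_from_clifford_action:
  fixes J :: "'z::real_inner \<Rightarrow> L2X \<Rightarrow> L2X"
  assumes "clifford_action J"
    and scaleC: "\<And>z c F. J z (scaleC_L2X c F) = scaleC_L2X c (J z F)"
    and skew: "\<And>z F G. herm_L2X (J z F) G = - herm_L2X F (J z G)"
    and bound: "\<And>z F. norm (J z F) \<le> norm z * norm F"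
  obtains \<Phi> where "complex_clifford_rep UNIV scaleC_L2X herm_L2X \<Phi>"
    "\<And>z F. \<Phi> (complexify (clifford_vec z)) F = J z F"
proof -
  interpret clifford_action J by fact
  interpret complex_hilbert_space_on UNIV scaleC_L2X herm_L2X by (rule complex_hilbert_space_L2X)
  define \<Phi> where "\<Phi> c F = clifford_op (re_part c) F + scaleC_L2X \<i> (clifford_op (im_part c) F)" for c F
  have comm: "clifford_op a (scaleC_L2X c F) = scaleC_L2X c (clifford_op a F)" for a c F
    by (rule clifford_op_commute[OF linear_scaleC_L2X scaleC])
  have ii: "scaleC_L2X \<i> (scaleC_L2X \<i> F) = - F" for F
    by (simp add: scaleC_L2X_scaleC scaleC_L2X_minus_one)
  note op = clifford_op_add clifford_op_diff clifford_op_mult clifford_op_scaleR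
    linear_add[OF linear_clifford_op] linear_add[OF linear_scaleC_L2X]
    linear_diff[OF linear_scaleC_L2X] scaleC_L2X_scaleR
  have vec: "\<Phi> (complexify (clifford_vec z)) F = J z F" for z F
    by (simp add: \<Phi>_def complexify_def clifford_op_vec clifford_op_0 linear_0[OF linear_scaleC_L2X])
  have "complex_clifford_rep UNIV scaleC_L2X herm_L2X \<Phi>"
  proof unfold_locales
    fix F G c d and a b :: "'z clifford complexified"
    show "\<Phi> a (F + G) = \<Phi> a F + \<Phi> a G" by (simp add: \<Phi>_def op)
    show "\<Phi> a (scaleC_L2X c F) = scaleC_L2X c (\<Phi> a F)"
      by (simp add: \<Phi>_def op comm scaleC_L2X_scaleC mult.commute)
    show "\<Phi> (a + b) F = \<Phi> a F + \<Phi> b F" by (simp add: \<Phi>_def op plus_complexified_def)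
    show "\<Phi> (cscale_complexified c a) F = scaleC_L2X c (\<Phi> a F)"
      by (simp add: \<Phi>_def op cscale_complexified_def scaleC_L2X_decompose[of c] ii algebra_simps)
    show "\<Phi> 1 F = F"
      by (simp add: \<Phi>_def one_complexified_def clifford_op_one clifford_op_0 linear_0[OF linear_scaleC_L2X])
    show "\<Phi> (a * b) F = \<Phi> a (\<Phi> b F)"
      by (simp add: \<Phi>_def op times_complexified_def comm ii algebra_simps)
    fix z
    show "herm_L2X (\<Phi> (complexify (clifford_vec z)) F) G = - herm_L2X F (\<Phi> (complexify (clifford_vec z)) G)"
      by (simp add: vec skew)
  next
    show "\<exists>K. \<forall>z. \<forall>F\<in>UNIV. norm (\<Phi> (complexify (clifford_vec z)) F) \<le> K * norm z * norm F"
      using bound by (intro exI[of _ 1]) (simp add: vec)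
  qed simp
  then show ?thesis using vec that by blast
qed

lemma bounded_linear_eq_on_total:
  fixes f g :: "'a::real_normed_vector \<Rightarrow> 'b::real_normed_vector"
  assumes "bounded_linear f" "bounded_linear g" and total: "closure (span B) = UNIV"
    and eq: "\<And>x. x \<in> B \<Longrightarrow> f x = g x"
  shows "f = g"
proof -
  have "span B \<subseteq> {x. f x = g x}"
    using linear_eq_on_span[of f g B] assms(1,2) eq bounded_linear.linear by blast
  moreover have "closed {x. f x = g x}"
    by (intro closed_Collect_eq linear_continuous_on assms)
  ultimately have "closure (span B) \<subseteq> {x. f x = g x}" by (rule closure_minimal)
  then show ?thesis using total by auto
qed

section \<open>Irreducibility and the absence of a complex structure\<close>

text \<open>
  A representation on \<open>L\<^sub>2(X)\<close> in which the vectors \<open>b n\<close>, total in \<open>Z\<close>, act by the operators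
  \<^const>\<open>generator\<close>. With \<open>b\<close> the sequence \<open>e 0, \<sigma> (e 0), e 1, \<sigma> (e 1), \<dots>\<close> this says that the
  representation is given by the prescribed formulas.
\<close>

locale generated_rep = complex_clifford_rep UNIV scaleC_L2X herm_L2X \<Phi>
  for \<Phi> :: "'z::real_inner clifford complexified \<Rightarrow> L2X \<Rightarrow> L2X" +
  fixes b :: "nat \<Rightarrow> 'z"
  assumes total: "closure (span (range b)) = UNIV"
    and generators: "\<Phi> (complexify (clifford_vec (b n))) F = generator n F"
begin

text \<open>The underlying action of the real Clifford algebra.\<close>

abbreviation \<rho> :: "'z clifford \<Rightarrow> L2X \<Rightarrow> L2X" where
  "\<rho> a \<equiv> \<Phi> (complexify a)"

lemma \<rho>_add: "\<rho> (a + a') F = \<rho> a F + \<rho> a' F"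
  by (simp add: complexify_add rep_add)

lemma \<rho>_mult: "\<rho> (a * a') F = \<rho> a (\<rho> a' F)"
  by (simp add: complexify_mult rep_mult)

lemma \<rho>_one: "\<rho> 1 F = F"
  by (simp add: complexify_one rep_one)

lemma \<rho>_scaleR: "\<rho> (r *\<^sub>R a) F = r *\<^sub>R \<rho> a F"
  by (simp add: complexify_scaleR rep_scaleC scaleC_L2X_of_real)

lemma \<rho>_op_add: "\<rho> a (F + G) = \<rho> a F + \<rho> a G"
  by (simp add: op_add)

lemma \<rho>_op_scaleC: "\<rho> a (scaleC_L2X c F) = scaleC_L2X c (\<rho> a F)"
  by (simp add: op_scaleC)

lemma \<rho>_op_scaleR: "\<rho> a (r *\<^sub>R F) = r *\<^sub>R \<rho> a F"
  by (simp add: scaleR_L2X_def op_scaleC)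

lemma \<Phi>_alt: "\<Phi> c F = \<rho> (re_part c) F + scaleC_L2X \<i> (\<rho> (im_part c) F)"
proof -
  have "\<Phi> (complexify (re_part c) + cscale_complexified \<i> (complexify (im_part c))) F =
      \<rho> (re_part c) F + scaleC_L2X \<i> (\<rho> (im_part c) F)"
    by (simp add: rep_add rep_scaleC)
  then show ?thesis by (simp only: complexified_decompose[symmetric])
qed

lemma bounded_linear_vec: "bounded_linear (\<lambda>z. \<rho> (clifford_vec z) F)"
proof -
  obtain K where "\<And>z. norm (\<rho> (clifford_vec z) F) \<le> K * norm z * norm F"
    using continuous by auto
  then show ?thesis
    by (intro bounded_linear_intro[where K = "K * norm F"])
      (simp_all add: clifford_vec_add clifford_vec_scaleR \<rho>_add \<rho>_scaleR ac_simps)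
qed

text \<open>The generators commute with the conjugation, hence so does \<open>C(Z)\<close>.\<close>

lemma conj_commute: "\<rho> a (conj_L2X F) = conj_L2X (\<rho> a F)"
proof (induction a arbitrary: F rule: clifford_induct)
  case (vec z)
  have "(\<lambda>z. \<rho> (clifford_vec z) (conj_L2X F)) = (\<lambda>z. conj_L2X (\<rho> (clifford_vec z) F))"
  proof (rule bounded_linear_eq_on_total[OF _ _ total])
    show "bounded_linear (\<lambda>z. conj_L2X (\<rho> (clifford_vec z) F))"
      by (rule bounded_linear_compose[OF bounded_linear_conj_L2X bounded_linear_vec])
    show "bounded_linear (\<lambda>z. \<rho> (clifford_vec z) (conj_L2X F))" by (rule bounded_linear_vec)
  qed (auto simp: generators generator_conj)
  then show ?case by meson
qed (simp_all add: \<rho>_add \<rho>_mult \<rho>_one \<rho>_scaleR conj_L2X_add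
    linear_scale[OF bounded_linear.linear[OF bounded_linear_conj_L2X]])

lemma invariant_L2X_real: "F \<in> L2X_real \<Longrightarrow> \<rho> a F \<in> L2X_real"
  by (simp add: L2X_real_iff conj_commute[symmetric])

text \<open>
  The decisive fact: only the real Clifford algebra is used, which is why it serves the complex and
  the real statements alike.
\<close>

lemma orbit_orthogonal_imp_zero:
  assumes "\<And>a. herm_L2X (\<rho> a F) G = 0"
  shows "F = 0 \<or> G = 0"
proof (rule generator_invariant_orthogonal)
  let ?V = "{H. \<forall>a. herm_L2X (\<rho> a H) G = 0}"
  show "F \<in> ?V" using assms by simp
  show "generator n H \<in> ?V" if "H \<in> ?V" for n H
  proof -
    have "herm_L2X (\<rho> (a * clifford_vec (b n)) H) G = 0" for a using that by blast
    then show ?thesis by (simp add: \<rho>_mult generators)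
  qed
  show "scaleC_L2X c H \<in> ?V" if "H \<in> ?V" for c H
    using that by (simp add: \<rho>_op_scaleC herm_L2X_scaleC_left)
  show "herm_L2X H G = 0" if "H \<in> ?V" for H
  proof -
    have "herm_L2X (\<rho> 1 H) G = 0" using that by blast
    then show ?thesis by (simp add: \<rho>_one)
  qed
qed

lemma irreducible_complex: "irreducible_complex UNIV scaleC_L2X \<Phi>"
  unfolding irreducible_complex_def
proof (intro allI impI, elim conjE)
  fix W :: "L2X set"
  assume W: "closed W" "subspace W" and scale: "\<forall>c. \<forall>F\<in>W. scaleC_L2X c F \<in> W"
    and inv: "invariant_under \<Phi> W"
  show "W = {0} \<or> W = UNIV"
  proof (cases "W \<subseteq> {0}")
    case False
    then obtain F where F: "F \<in> W" "F \<noteq> 0" by auto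
    have "v \<in> W" for v
    proof -
      obtain w where w: "w \<in> W" "\<forall>u\<in>W. (v - w) \<bullet> u = 0"
        using orthogonal_projection_exists[of W v] W by (auto simp: complete_eq_closed)
      have "herm_L2X u (v - w) = 0" if u: "u \<in> W" for u
      proof -
        \<comment> \<open>Real orthogonality to \<open>u\<close> and to \<open>- \<i> u\<close> is hermitian orthogonality to \<open>u\<close>.\<close>
        have "scaleC_L2X (- \<i>) u \<in> W" using u scale by blast
        moreover have "Re (herm_L2X u' (v - w)) = 0" if "u' \<in> W" for u'
          using w that by (metis Re_herm_L2X inner_commute)
        ultimately have "Re (herm_L2X u (v - w)) = 0" "Re (herm_L2X (scaleC_L2X (- \<i>) u) (v - w)) = 0"
          using u by blast+
        then show ?thesis by (simp add: herm_L2X_scaleC_left complex_eq_iff)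
      qed
      then have "F = 0 \<or> v - w = 0"
        using inv F by (intro orbit_orthogonal_imp_zero) (simp add: invariant_under_def)
      then show ?thesis using F w by simp
    qed
    then show ?thesis by auto
  qed (use subspace_0[OF W(2)] in auto)
qed

lemma irreducible_real: "irreducible_real L2X_real (restrict_to_real \<Phi>)"
  unfolding irreducible_real_def
proof (intro allI impI, elim conjE)
  fix W :: "L2X set"
  assume W: "closed W" "subspace W" and sub: "W \<subseteq> L2X_real"
    and inv: "invariant_under (restrict_to_real \<Phi>) W"
  show "W = {0} \<or> W = L2X_real"
  proof (cases "W \<subseteq> {0}")
    case False
    then obtain F where F: "F \<in> W" "F \<noteq> 0" by auto
    have "v \<in> W" if v: "v \<in> L2X_real" for v
    proof -
      obtain w where w: "w \<in> W" "\<forall>u\<in>W. (v - w) \<bullet> u = 0"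
        using orthogonal_projection_exists[of W v] W by (auto simp: complete_eq_closed)
      \<comment> \<open>On the real subspace the hermitian product is the real one.\<close>
      have real: "v - w \<in> L2X_real" using v w sub subspace_diff[OF subspace_L2X_real] by blast
      have "herm_L2X u (v - w) = 0" if "u \<in> W" for u
        using herm_L2X_real[OF _ real, of u] that sub w by (auto simp: inner_commute)
      then have "F = 0 \<or> v - w = 0"
        using inv F by (intro orbit_orthogonal_imp_zero) (simp add: invariant_under_def restrict_to_real_def)
      then show ?thesis using F w by simp
    qed
    then show ?thesis using sub by auto
  qed (use subspace_0[OF W(2)] in auto)
qed

lemma real_clifford_rep_L2X_real: "real_clifford_rep L2X_real (restrict_to_real \<Phi>)"
proof unfold_locales
  show "subspace L2X_real" by (rule subspace_L2X_real)
  show "complete L2X_real" by (simp add: complete_eq_closed closed_L2X_real)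
  show "\<exists>D. countable D \<and> D \<subseteq> L2X_real \<and> L2X_real \<subseteq> closure D" by (rule L2X_real_separable)
  show "\<exists>K. \<forall>z. \<forall>v\<in>L2X_real. norm (restrict_to_real \<Phi> (clifford_vec z) v) \<le> K * norm z * norm v"
    using continuous by (auto simp: restrict_to_real_def)
  show "restrict_to_real \<Phi> (clifford_vec z) u \<bullet> v = - (u \<bullet> restrict_to_real \<Phi> (clifford_vec z) v)" for z u v
    using skew[of u v z] by (simp add: restrict_to_real_def inner_L2X_def)
qed (simp_all add: restrict_to_real_def invariant_L2X_real \<rho>_add \<rho>_mult \<rho>_one \<rho>_scaleR
    \<rho>_op_add \<rho>_op_scaleR)

lemma not_arises_by_restriction: "\<not> arises_by_restriction_of_scalars L2X_real (restrict_to_real \<Phi>)"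
proof
  assume "arises_by_restriction_of_scalars L2X_real (restrict_to_real \<Phi>)"
  then obtain scaleC herm \<Psi> where \<Psi>: "complex_clifford_rep L2X_real scaleC herm \<Psi>"
    and restr: "\<And>a v. v \<in> L2X_real \<Longrightarrow> restrict_to_real \<Psi> a v = \<rho> a v"
    unfolding arises_by_restriction_of_scalars_def restrict_to_real_def by blast
  interpret \<Psi>: complex_clifford_rep L2X_real scaleC herm \<Psi> by fact
  \<comment> \<open>The second complex structure; it commutes with the action and is orthogonal.\<close>
  define T where "T = scaleC \<i>"
  have T_closed: "T u \<in> L2X_real" if "u \<in> L2X_real" for u
    using that by (simp add: T_def \<Psi>.scaleC_closed)
  have T_comm: "T (\<rho> a u) = \<rho> a (T u)" if "u \<in> L2X_real" for a u
    using restr[OF that] restr[OF T_closed[OF that]] \<Psi>.op_scaleC[OF that]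
    by (metis T_def restrict_to_real_def)
  have T_square: "T (T u) = - u" if "u \<in> L2X_real" for u
    using \<Psi>.scaleC_of_real[OF that, of "-1"] by (simp add: T_def \<Psi>.scaleC_scaleC[OF that])
  have T_isometry: "T u \<bullet> T v = u \<bullet> v" if u: "u \<in> L2X_real" and v: "v \<in> L2X_real" for u v
  proof -
    have "herm (T u) (T v) = \<i> * cnj (\<i> * herm v u)"
      using \<Psi>.herm_scaleC_left[OF u T_closed[OF v]] \<Psi>.herm_scaleC_left[OF v u]
        \<Psi>.herm_commute[OF T_closed[OF v] u] by (simp add: T_def)
    also have "\<dots> = herm u v" using \<Psi>.herm_commute[OF v u] by simp
    finally show ?thesis
      using \<Psi>.Re_herm[OF u v] \<Psi>.Re_herm[OF T_closed[OF u] T_closed[OF v]] by simp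
  qed
  have T_skew: "T u \<bullet> v = - (u \<bullet> T v)" if u: "u \<in> L2X_real" and v: "v \<in> L2X_real" for u v
    using T_isometry[OF T_closed[OF u] v] T_square[OF u] by simp
  let ?f = "abs_L2X (\<lambda>_. 1)"
  have f: "?f \<in> L2X_real" "?f \<noteq> 0" by (rule one_in_L2X_real)+
  \<comment> \<open>The vectors \<open>?p u\<close> and \<open>?g\<close> lie in the eigenspaces for \<open>\<i>\<close> and \<open>- \<i>\<close> of the complex linear extension of \<open>T\<close>.\<close>
  let ?p = "\<lambda>u. u + scaleC_L2X (- \<i>) (T u)" and ?g = "?f + scaleC_L2X \<i> (T ?f)"
  have "herm_L2X (\<rho> a (?p ?f)) ?g = 0" for a
  proof -
    define u where "u = \<rho> a ?f"
    have u: "u \<in> L2X_real" unfolding u_def by (intro invariant_L2X_real f)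
    have "\<rho> a (?p ?f) = ?p u"
      using f(1) by (simp add: u_def \<rho>_op_add \<rho>_op_scaleC T_comm)
    moreover have "herm_L2X (?p u) ?g = 0"
      using u f(1) T_skew[OF u f(1)] T_isometry[OF u f(1)]
      by (simp add: herm_L2X_add_left herm_L2X_add_right herm_L2X_scaleC_left herm_L2X_scaleC_right
          herm_L2X_real T_closed algebra_simps)
    ultimately show ?thesis by simp
  qed
  then have "?p ?f = 0 \<or> ?g = 0" by (rule orbit_orthogonal_imp_zero)
  moreover have "Re (herm_L2X (?p ?f) ?f) = ?f \<bullet> ?f" "Re (herm_L2X ?g ?f) = ?f \<bullet> ?f"
    using f(1) by (simp_all add: herm_L2X_add_left herm_L2X_scaleC_left herm_L2X_real T_closed)
  moreover have "herm_L2X 0 ?f = 0"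
    using herm_L2X_scaleC_left[of 0 0 ?f] by (simp add: linear_0[OF linear_scaleC_L2X])
  ultimately have "?f \<bullet> ?f = 0" by auto
  then show False using f(2) by simp
qed

end

lemma generated_rep_unique:
  assumes "generated_rep \<Phi> b" "generated_rep \<Psi> b"
  shows "\<Phi> = \<Psi>"
proof -
  interpret \<Phi>: generated_rep \<Phi> b by fact
  interpret \<Psi>: generated_rep \<Psi> b by fact
  have eq: "\<Phi> (complexify a) F = \<Psi> (complexify a) F" for a F
  proof (induction a arbitrary: F rule: clifford_induct)
    case (vec z)
    have "(\<lambda>z. \<Phi>.\<rho> (clifford_vec z) F) = (\<lambda>z. \<Psi>.\<rho> (clifford_vec z) F)"
      by (rule bounded_linear_eq_on_total[OF \<Phi>.bounded_linear_vec \<Psi>.bounded_linear_vec \<Phi>.total])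
        (auto simp: \<Phi>.generators \<Psi>.generators)
    then show ?case by meson
  qed (simp_all add: \<Phi>.\<rho>_add \<Psi>.\<rho>_add \<Phi>.\<rho>_mult \<Psi>.\<rho>_mult \<Phi>.\<rho>_one \<Psi>.\<rho>_one \<Phi>.\<rho>_scaleR \<Psi>.\<rho>_scaleR)
  have "\<Phi> c F = \<Psi> c F" for c F
    unfolding \<Phi>.\<Phi>_alt[of c F] \<Psi>.\<Phi>_alt[of c F] by (simp only: eq)
  then show ?thesis by (intro ext)
qed

section \<open>The real orthonormal basis of $Z$\<close>

text \<open>The sequence \<open>e 0, \<sigma> (e 0), e 1, \<sigma> (e 1), \<dots>\<close>.\<close>

definition real_basis :: "('z \<Rightarrow> 'z) \<Rightarrow> (nat \<Rightarrow> 'z) \<Rightarrow> nat \<Rightarrow> 'z" where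
  "real_basis \<sigma> e n = (if even n then e (n div 2) else \<sigma> (e (n div 2)))"

lemma range_real_basis: "range (real_basis \<sigma> e) = range e \<union> range (\<lambda>k. \<sigma> (e k))"
proof (intro equalityI subsetI)
  fix x assume "x \<in> range e \<union> range (\<lambda>k. \<sigma> (e k))"
  then obtain k where "x = e k \<or> x = \<sigma> (e k)" by auto
  then have "x = real_basis \<sigma> e (2 * k) \<or> x = real_basis \<sigma> e (2 * k + 1)"
    by (simp add: real_basis_def)
  then show "x \<in> range (real_basis \<sigma> e)" by blast
qed (auto simp: real_basis_def)

lemma real_basis_orthonormal:
  assumes "orthogonal_complex_structure \<sigma>" "unitary_basis \<sigma> e"
  shows "real_basis \<sigma> e m \<bullet> real_basis \<sigma> e n = of_bool (m = n)"
proof -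
  have herm: "hermitian_form \<sigma> (e j) (e k) = (if j = k then 1 else 0)" for j k
    using assms(2) by (simp add: unitary_basis_def)
  have e: "e j \<bullet> e k = of_bool (j = k)" "e j \<bullet> \<sigma> (e k) = 0" for j k
    using herm[of j k] by (auto simp: hermitian_form_def complex_eq_iff split: if_splits)
  have "\<sigma> (e j) \<bullet> \<sigma> (e k) = of_bool (j = k)" for j k
    using assms(1) e by (simp add: orthogonal_complex_structure_def orthogonal_transformation_def)
  moreover have "m = n \<longleftrightarrow> m div 2 = n div 2 \<and> (even m \<longleftrightarrow> even n)"
    by presburger
  ultimately show ?thesis
    using e by (cases "even m"; cases "even n") (simp_all add: real_basis_def inner_commute[of "\<sigma> _" "e _"])
qed

lemma AE_fun_of_generator:
  "AE x in haar_X. fun_of (generator n F) x = phase n x * fun_of F (x \<oplus>\<^sub>X delta (n div 2))"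
  using AE_fun_of_abs[OF square_integrable_generator[OF square_integrable_fun_of[of F]], of n]
    generator_abs[OF square_integrable_fun_of[of F], of n] by simp

lemma phase_even: "(-1) ^ ((\<Sum>j<k. of_bool (x j)) + 1) * \<i> * c_fun k x = phase (2 * k) x"
proof -
  have "(-1) ^ (\<Sum>j<k. of_bool (x j)) = walsh {..<k} x"
    unfolding walsh_def rademacher_def by (rule power_sum)
  then show ?thesis by (simp only: power_add) (simp add: phase_def)
qed

lemma acts_by_formulas_iff:
  "acts_by_formulas c_fun \<sigma> e \<Phi> \<longleftrightarrow>
    (\<forall>n F. \<Phi> (complexify (clifford_vec (real_basis \<sigma> e n))) F = generator n F)" (is "?L \<longleftrightarrow> ?R")
proof
  assume L: ?L
  have even: "\<Phi> (complexify (clifford_vec (e k))) F = generator (2 * k) F" for k F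
  proof (rule L2X_eqI)
    have "AE x in haar_X. fun_of (\<Phi> (complexify (clifford_vec (e k))) F) x =
        phase (2 * k) x * fun_of F (x \<oplus>\<^sub>X delta k)"
      using L unfolding acts_by_formulas_def phase_even by blast
    with AE_fun_of_generator[of "2 * k" F]
    show "AE x in haar_X. fun_of (\<Phi> (complexify (clifford_vec (e k))) F) x = fun_of (generator (2 * k) F) x"
      by eventually_elim simp
  qed
  have odd: "\<Phi> (complexify (clifford_vec (\<sigma> (e k)))) F = generator (2 * k + 1) F" for k F
  proof (rule L2X_eqI)
    have "AE x in haar_X. fun_of (\<Phi> (complexify (clifford_vec (\<sigma> (e k)))) F) x =
        (-1) ^ of_bool (x k) * \<i> * fun_of (generator (2 * k) F) x"
      using L unfolding acts_by_formulas_def even by blast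
    with AE_fun_of_generator[of "2 * k" F] AE_fun_of_generator[of "2 * k + 1" F]
    show "AE x in haar_X. fun_of (\<Phi> (complexify (clifford_vec (\<sigma> (e k)))) F) x =
        fun_of (generator (2 * k + 1) F) x"
    proof eventually_elim
      case (elim x)
      then show ?case using phase_odd[of k x] by (simp add: mult.assoc)
    qed
  qed
  have "\<Phi> (complexify (clifford_vec (real_basis \<sigma> e n))) F = generator n F" for n F
    using even[of "n div 2" F] odd[of "n div 2" F] by (cases "even n") (simp_all add: real_basis_def)
  then show ?R by blast
next
  assume R: ?R
  have even: "\<Phi> (complexify (clifford_vec (e k))) F = generator (2 * k) F" for k F
    using R[rule_format, of "2 * k" F] by (simp add: real_basis_def)
  have odd: "\<Phi> (complexify (clifford_vec (\<sigma> (e k)))) F = generator (2 * k + 1) F" for k F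
    using R[rule_format, of "2 * k + 1" F] by (simp add: real_basis_def)
  have even_phase: "AE x in haar_X. fun_of (generator (2 * k) F) x = phase (2 * k) x * fun_of F (x \<oplus>\<^sub>X delta k)"
    for k F using AE_fun_of_generator[of "2 * k" F] by simp
  have "AE x in haar_X. fun_of (generator (2 * k + 1) F) x =
      (-1) ^ of_bool (x k) * \<i> * fun_of (generator (2 * k) F) x" for k F
    using AE_fun_of_generator[of "2 * k" F] AE_fun_of_generator[of "2 * k + 1" F]
  proof eventually_elim
    case (elim x)
    then show ?case using phase_odd[of k x] by (simp add: mult.assoc)
  qed
  then show ?L unfolding acts_by_formulas_def even odd phase_even
    using even_phase by blast
qed

theorem theorem3p11:
  fixes \<sigma> :: "'z::{real_inner, polish_space} \<Rightarrow> 'z"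
    and e :: "nat \<Rightarrow> 'z"
  assumes inf_dim: "\<nexists>B. finite B \<and> span B = (UNIV :: 'z set)"
    and complex_structure: "orthogonal_complex_structure \<sigma>"
    and basis: "unitary_basis \<sigma> e"
  shows "(\<forall>k x. cmod (c_fun k x) = 1) \<and>
    (\<forall>k x. cnj (c_fun k x) = c_fun k (x \<oplus>\<^sub>X delta k)) \<and>
    (\<forall>k l x. c_fun k x * c_fun l (x \<oplus>\<^sub>X delta k) = c_fun l x * c_fun k (x \<oplus>\<^sub>X delta l)) \<and>
    (\<exists>!\<Phi>. complex_clifford_rep UNIV scaleC_L2X herm_L2X \<Phi> \<and> acts_by_formulas c_fun \<sigma> e \<Phi>) \<and>
    (\<forall>\<Phi>. complex_clifford_rep UNIV scaleC_L2X herm_L2X \<Phi> \<and> acts_by_formulas c_fun \<sigma> e \<Phi> \<longrightarrow>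
       irreducible_complex UNIV scaleC_L2X \<Phi> \<and>
       invariant_under (restrict_to_real \<Phi>) L2X_real \<and>
       real_clifford_rep L2X_real (restrict_to_real \<Phi>) \<and>
       irreducible_real L2X_real (restrict_to_real \<Phi>) \<and>
       \<not> arises_by_restriction_of_scalars L2X_real (restrict_to_real \<Phi>))"
proof (intro conjI)
  let ?b = "real_basis \<sigma> e"
  have total: "closure (span (range ?b)) = UNIV"
    using basis by (simp add: range_real_basis unitary_basis_def)
  have rep_iff: "complex_clifford_rep UNIV scaleC_L2X herm_L2X \<Phi> \<and> acts_by_formulas c_fun \<sigma> e \<Phi> \<longleftrightarrow>
      generated_rep \<Phi> ?b" for \<Phi> :: "'z clifford complexified \<Rightarrow> L2X \<Rightarrow> L2X"
    by (auto simp: generated_rep_def generated_rep_axioms_def acts_by_formulas_iff total)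
  interpret orthonormal_clifford_system ?b generator
  proof (rule orthonormal_clifford_system.intro)
    show "generator n F \<bullet> G = - (F \<bullet> generator n G)" for n F G
      using herm_generator[of n F G] by (simp add: inner_L2X_def)
  qed (rule real_basis_orthonormal[OF complex_structure basis] total linear_generator
      generator_square generator_anticommute, assumption?)+
  have scaleC: "vec_op z (scaleC_L2X c F) = scaleC_L2X c (vec_op z F)" for z c F
    by (rule vec_op_commute[OF bounded_linear_scaleC_L2X generator_scaleC])
  have "clifford_action vec_op"
    by (intro clifford_action.intro linear_vec_op linear_vec_op_left vec_op_clifford)
  moreover have "herm_L2X (vec_op z F) G = - herm_L2X F (vec_op z G)" for z F G
    using vec_op_skew[of z F G] vec_op_skew[of z F "scaleC_L2X \<i> G"]
    by (simp add: complex_eq_iff Re_herm_L2X Im_herm_L2X scaleC)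
  ultimately obtain \<Phi> where \<Phi>: "complex_clifford_rep UNIV scaleC_L2X herm_L2X \<Phi>"
    "\<And>z F. \<Phi> (complexify (clifford_vec z)) F = vec_op z F"
    using complex_rep_from_clifford_action[of vec_op] scaleC norm_vec_op by (metis order_refl)
  then have "generated_rep \<Phi> ?b"
    by (simp add: generated_rep_def generated_rep_axioms_def total vec_op_basis)
  then show "\<exists>!\<Phi>. complex_clifford_rep UNIV scaleC_L2X herm_L2X \<Phi> \<and> acts_by_formulas c_fun \<sigma> e \<Phi>"
    unfolding rep_iff using generated_rep_unique by blast
  show "\<forall>\<Phi>. complex_clifford_rep UNIV scaleC_L2X herm_L2X \<Phi> \<and> acts_by_formulas c_fun \<sigma> e \<Phi> \<longrightarrow>
       irreducible_complex UNIV scaleC_L2X \<Phi> \<and>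
       invariant_under (restrict_to_real \<Phi>) L2X_real \<and>
       real_clifford_rep L2X_real (restrict_to_real \<Phi>) \<and>
       irreducible_real L2X_real (restrict_to_real \<Phi>) \<and>
       \<not> arises_by_restriction_of_scalars L2X_real (restrict_to_real \<Phi>)"
    unfolding rep_iff
  proof (intro allI impI conjI)
    fix \<Phi> :: "'z clifford complexified \<Rightarrow> L2X \<Rightarrow> L2X" assume "generated_rep \<Phi> ?b"
    then interpret rep: generated_rep \<Phi> ?b .
    show "invariant_under (restrict_to_real \<Phi>) L2X_real"
      by (simp add: invariant_under_def restrict_to_real_def rep.invariant_L2X_real)
    show "irreducible_complex UNIV scaleC_L2X \<Phi>" by (rule rep.irreducible_complex)
    show "real_clifford_rep L2X_real (restrict_to_real \<Phi>)" by (rule rep.real_clifford_rep_L2X_real)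
    show "irreducible_real L2X_real (restrict_to_real \<Phi>)" by (rule rep.irreducible_real)
    show "\<not> arises_by_restriction_of_scalars L2X_real (restrict_to_real \<Phi>)"
      by (rule rep.not_arises_by_restriction)
  qed
  show "\<forall>k x. cnj (c_fun k x) = c_fun k (x \<oplus>\<^sub>X delta k)" by (simp add: c_fun_delta_self)
  show "\<forall>k l x. c_fun k x * c_fun l (x \<oplus>\<^sub>X delta k) = c_fun l x * c_fun k (x \<oplus>\<^sub>X delta l)"
    by (intro allI c_fun_cocycle)
qed simp

end
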